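(* Let $n,m\ge 1$ and $0\le r\le m$ be integers. Then the set $$\widehat{\mathcal M}_r=\{(A,Y)\in\mathbb R^{n\times m}\times Gr(m-r,m)\;:\;AY=0\}$$ is a smooth manifold of dimension $(n+m)r-r^2$.
   Context: $Gr(m-r,m)=\mathbb R_*^{m,m-r}/GL_{m-r}$ is the Grassmann manifold, where $\mathbb R_*^{m,m-r}=\{Y\in\mathbb R^{m\times(m-r)}: Y\text{ has full rank}\}$ is the noncompact Stiefel manifold and $GL_{m-r}$ (the group of invertible $(m-r)\times(m-r)$ real matrices) acts by right multiplication. For a class $Y\in Gr(m-r,m)$, the condition $AY=0$ means that it holds for one (equivalently, every) full-rank matrix representing the class. "Manifold" means $C^\infty$ manifold; $\widehat{\mathcal M}_r$ is regarded as a subset of the product manifold $\mathbb R^{n\times m}\times Gr(m-r,m)$, i.e. the assertion is that it is a smooth (embedded) submanifold of this product. *)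

theory Defs
  imports
    "HOL-Analysis.Analysis"
    "Jordan_Normal_Form.DL_Rank"
    "Jordan_Normal_Form.DL_Submatrix"
begin

section \<open>Smooth manifolds and embedded submanifolds\<close>

text \<open>
  The model space of dimension \<open>d\<close> is \<^const>\<open>Euclidean_space\<close> \<open>d\<close>: sequences of reals that vanish
  from index \<open>d\<close> on.  In this way the dimension is an ordinary natural number (possibly 0), and
  \<open>\<real>\<^sup>d\<close> is literally contained in \<open>\<real>\<^sup>N\<close> for \<open>d \<le> N\<close>, as the common zero set of the last \<open>N - d\<close>
  coordinates.
\<close>

text \<open>
  \<open>C_k_on k d W f\<close>: on the set \<open>W\<close>, which is meant to be open in \<open>\<real>\<^sup>d\<close>, all partial derivatives of
  \<open>f\<close> of order at most \<open>k\<close> exist and are continuous.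
\<close>

primrec C_k_on :: "nat \<Rightarrow> nat \<Rightarrow> (nat \<Rightarrow> real) set \<Rightarrow> ((nat \<Rightarrow> real) \<Rightarrow> real) \<Rightarrow> bool" where
  "C_k_on 0 d W f \<longleftrightarrow> continuous_map (subtopology (Euclidean_space d) W) euclideanreal f"
| "C_k_on (Suc k) d W f \<longleftrightarrow>
     continuous_map (subtopology (Euclidean_space d) W) euclideanreal f \<and>
     (\<forall>i<d. \<exists>g. (\<forall>x\<in>W. ((\<lambda>t. f (x(i := t))) has_real_derivative g x) (at (x i))) \<and>
                C_k_on k d W g)"

definition smooth_map_on ::
  "nat \<Rightarrow> nat \<Rightarrow> (nat \<Rightarrow> real) set \<Rightarrow> ((nat \<Rightarrow> real) \<Rightarrow> nat \<Rightarrow> real) \<Rightarrow> bool" where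
  "smooth_map_on d e W F \<longleftrightarrow> (\<forall>j<e. \<forall>k. C_k_on k d W (\<lambda>x. F x j))"

type_synonym 'a chart = "'a set \<times> ('a \<Rightarrow> nat \<Rightarrow> real)"

definition chart_on :: "nat \<Rightarrow> 'a topology \<Rightarrow> 'a chart \<Rightarrow> bool" where
  "chart_on d X = (\<lambda>(U, \<phi>).
     openin X U \<and> openin (Euclidean_space d) (\<phi> ` U) \<and>
     homeomorphic_map (subtopology X U) (subtopology (Euclidean_space d) (\<phi> ` U)) \<phi>)"

definition smooth_transition :: "nat \<Rightarrow> 'a chart \<Rightarrow> 'a chart \<Rightarrow> bool" where
  "smooth_transition d = (\<lambda>(U, \<phi>) (V, \<psi>).
     smooth_map_on d d (\<phi> ` (U \<inter> V)) (\<psi> \<circ> inv_into U \<phi>))"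

definition compatible_charts :: "nat \<Rightarrow> 'a chart \<Rightarrow> 'a chart \<Rightarrow> bool" where
  "compatible_charts d c c' \<longleftrightarrow> smooth_transition d c c' \<and> smooth_transition d c' c"

record 'a manifold =
  mfd_dim :: nat
  mfd_top :: "'a topology"
  mfd_atlas :: "'a chart set"

definition smooth_manifold :: "'a manifold \<Rightarrow> bool" where
  "smooth_manifold M \<longleftrightarrow>
     Hausdorff_space (mfd_top M) \<and> second_countable (mfd_top M) \<and>
     (\<forall>c \<in> mfd_atlas M. chart_on (mfd_dim M) (mfd_top M) c) \<and>
     (\<Union>(U, \<phi>) \<in> mfd_atlas M. U) = topspace (mfd_top M) \<and>
     (\<forall>c \<in> mfd_atlas M. \<forall>c' \<in> mfd_atlas M. compatible_charts (mfd_dim M) c c')"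

definition maximal_atlas :: "'a manifold \<Rightarrow> 'a chart set" where
  "maximal_atlas M =
     {c. chart_on (mfd_dim M) (mfd_top M) c \<and>
         (\<forall>c' \<in> mfd_atlas M. compatible_charts (mfd_dim M) c c')}"

text \<open>
  \<open>S\<close> is an embedded \<open>d\<close>-dimensional submanifold of the smooth manifold \<open>M\<close> if every point of \<open>S\<close>
  lies in the domain of a slice chart.  Restrictions of the slice charts are the charts of the
  smooth structure of \<open>S\<close> (with the subspace topology).  Without \<open>d \<le> mfd_dim M\<close> the slice
  condition would degenerate to \<open>S\<close> being open in \<open>M\<close>.
\<close>

definition embedded_submanifold :: "'a manifold \<Rightarrow> 'a set \<Rightarrow> nat \<Rightarrow> bool" where
  "embedded_submanifold M S d \<longleftrightarrow>
     smooth_manifold M \<and> S \<subseteq> topspace (mfd_top M) \<and> d \<le> mfd_dim M \<and>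
     (\<forall>p\<in>S. \<exists>(U, \<phi>) \<in> maximal_atlas M.
        p \<in> U \<and> \<phi> ` (U \<inter> S) = \<phi> ` U \<inter> topspace (Euclidean_space d))"

definition prod_chart :: "nat \<Rightarrow> 'a chart \<Rightarrow> 'b chart \<Rightarrow> ('a \<times> 'b) chart" where
  "prod_chart d = (\<lambda>(U, \<phi>) (V, \<psi>).
     (U \<times> V, \<lambda>(x, y) i. if i < d then \<phi> x i else \<psi> y (i - d)))"

definition prod_manifold :: "'a manifold \<Rightarrow> 'b manifold \<Rightarrow> ('a \<times> 'b) manifold" where
  "prod_manifold M N =
     \<lparr>mfd_dim = mfd_dim M + mfd_dim N,
      mfd_top = prod_topology (mfd_top M) (mfd_top N),
      mfd_atlas = {prod_chart (mfd_dim M) c c' | c c'. c \<in> mfd_atlas M \<and> c' \<in> mfd_atlas N}\<rparr>"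


section \<open>Spaces of matrices\<close>

text \<open>The entries of an \<open>n \<times> m\<close> matrix, read row by row.\<close>

definition mat_coords :: "nat \<Rightarrow> nat \<Rightarrow> real mat \<Rightarrow> nat \<Rightarrow> real" where
  "mat_coords n m A = (\<lambda>i. if i < n * m then A $$ (i div m, i mod m) else 0)"

definition mat_topology :: "nat \<Rightarrow> nat \<Rightarrow> real mat topology" where
  "mat_topology n m = pullback_topology (carrier_mat n m) (mat_coords n m) (Euclidean_space (n * m))"

definition mat_manifold :: "nat \<Rightarrow> nat \<Rightarrow> real mat manifold" where
  "mat_manifold n m =
     \<lparr>mfd_dim = n * m, mfd_top = mat_topology n m,
      mfd_atlas = {(carrier_mat n m, mat_coords n m)}\<rparr>"


section \<open>Grassmann manifolds\<close>

definition stiefel :: "nat \<Rightarrow> nat \<Rightarrow> real mat set" where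
  "stiefel m k = {Y \<in> carrier_mat m k. vec_space.rank m Y = k}"

definition GL_mat :: "nat \<Rightarrow> real mat set" where
  "GL_mat k = {G \<in> carrier_mat k k. invertible_mat G}"

definition GL_orbit :: "nat \<Rightarrow> real mat \<Rightarrow> real mat set" where
  "GL_orbit k Y = {Y * G | G. G \<in> GL_mat k}"

definition grassmannian :: "nat \<Rightarrow> nat \<Rightarrow> real mat set set" where
  "grassmannian k m = GL_orbit k ` stiefel m k"

text \<open>The quotient topology; see \<open>quotient_map_GL_orbit\<close> below.\<close>

definition grassmann_topology :: "nat \<Rightarrow> nat \<Rightarrow> real mat set topology" where
  "grassmann_topology k m = topology (\<lambda>\<U>. \<U> \<subseteq> grassmannian k m \<and>
     openin (subtopology (mat_topology m k) (stiefel m k)) {Y \<in> stiefel m k. GL_orbit k Y \<in> \<U>})"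

text \<open>
  The standard chart belonging to a set \<open>J\<close> of \<open>k\<close> row indices.  Write \<open>Y\<^sub>J\<close> for the \<open>k \<times> k\<close>
  submatrix of the rows in \<open>J\<close>, and \<open>Y\<^sub>J\<^sub>c\<close> for the \<open>(m - k) \<times> k\<close> submatrix of the remaining rows.
  The domain consists of the classes whose representatives have invertible \<open>Y\<^sub>J\<close>, and the class of
  \<open>Y\<close> is mapped to the entries of \<open>X = Y\<^sub>J\<^sub>c Y\<^sub>J\<^sup>-\<^sup>1\<close>, which does not depend on the representative.
\<close>

definition grassmann_chart :: "nat \<Rightarrow> nat \<Rightarrow> nat set \<Rightarrow> real mat set chart" where
  "grassmann_chart k m J =
     ({c \<in> grassmannian k m. \<forall>Y\<in>c. invertible_mat (submatrix Y J UNIV)},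
      \<lambda>c. mat_coords (m - k) k
            (THE X. X \<in> carrier_mat (m - k) k \<and>
                    (\<forall>Y\<in>c. X * submatrix Y J UNIV = submatrix Y (- J) UNIV)))"

definition grassmann_manifold :: "nat \<Rightarrow> nat \<Rightarrow> real mat set manifold" where
  "grassmann_manifold k m =
     \<lparr>mfd_dim = (m - k) * k, mfd_top = grassmann_topology k m,
      mfd_atlas = {grassmann_chart k m J | J. J \<subseteq> {..<m} \<and> card J = k}\<rparr>"

lemma openin_grassmann_topology:
  "openin (grassmann_topology k m) \<U> \<longleftrightarrow> \<U> \<subseteq> grassmannian k m \<and>
     openin (subtopology (mat_topology m k) (stiefel m k)) {Y \<in> stiefel m k. GL_orbit k Y \<in> \<U>}"
proof -
  let ?X = "subtopology (mat_topology m k) (stiefel m k)"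
  have *: "{Y \<in> stiefel m k. GL_orbit k Y \<in> S \<inter> T} =
        {Y \<in> stiefel m k. GL_orbit k Y \<in> S} \<inter> {Y \<in> stiefel m k. GL_orbit k Y \<in> T}" for S T
    by auto
  have **: "{Y \<in> stiefel m k. GL_orbit k Y \<in> \<Union>\<K>} =
        (\<Union>S\<in>\<K>. {Y \<in> stiefel m k. GL_orbit k Y \<in> S})" for \<K>
    by auto
  have "istopology (\<lambda>\<U>. \<U> \<subseteq> grassmannian k m \<and> openin ?X {Y \<in> stiefel m k. GL_orbit k Y \<in> \<U>})"
    unfolding istopology_def * ** by (blast intro: openin_Int openin_Union)
  then show ?thesis
    unfolding grassmann_topology_def by (simp add: topology_inverse')
qed

lemma topspace_mat_topology: "topspace (mat_topology n m) = carrier_mat n m"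
  by (auto simp: mat_topology_def topspace_pullback_topology topspace_Euclidean_space mat_coords_def)

lemma topspace_stiefel: "topspace (subtopology (mat_topology m k) (stiefel m k)) = stiefel m k"
  by (auto simp: topspace_mat_topology stiefel_def)

lemma topspace_grassmann_topology: "topspace (grassmann_topology k m) = grassmannian k m"
proof
  have "openin (grassmann_topology k m) (grassmannian k m)"
    using openin_topspace [of "subtopology (mat_topology m k) (stiefel m k)"]
    unfolding openin_grassmann_topology topspace_stiefel
    by (auto simp: grassmannian_def cong: conj_cong)
  then show "grassmannian k m \<subseteq> topspace (grassmann_topology k m)"
    by (rule openin_subset)
qed (use openin_grassmann_topology openin_topspace in blast)

lemma quotient_map_GL_orbit:
  "quotient_map (subtopology (mat_topology m k) (stiefel m k)) (grassmann_topology k m) (GL_orbit k)"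
  unfolding quotient_map_def topspace_stiefel topspace_grassmann_topology openin_grassmann_topology
  by (auto simp: grassmannian_def)


section \<open>The set of pairs\<close>

definition M_hat :: "nat \<Rightarrow> nat \<Rightarrow> nat \<Rightarrow> (real mat \<times> real mat set) set" where
  "M_hat n m r = {(A, c). A \<in> carrier_mat n m \<and> c \<in> grassmannian (m - r) m \<and>
                          (\<forall>Y\<in>c. A * Y = 0\<^sub>m n (m - r))}"

lemma annihilates_class_iff:
  assumes "A \<in> carrier_mat n m" and "Y \<in> stiefel m k"
  shows "(\<forall>Z \<in> GL_orbit k Y. A * Z = 0\<^sub>m n k) \<longleftrightarrow> A * Y = 0\<^sub>m n k"
proof
  have Y: "Y \<in> carrier_mat m k"
    using assms by (simp add: stiefel_def)
  have "1\<^sub>m k \<in> GL_mat k"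
    by (auto simp: GL_mat_def invertible_mat_def inverts_mat_def square_mat.simps
        intro!: exI [of _ "1\<^sub>m k"])
  then have "Y * 1\<^sub>m k \<in> GL_orbit k Y"
    by (auto simp: GL_orbit_def)
  then have "Y \<in> GL_orbit k Y"
    using Y by simp
  then show "A * Y = 0\<^sub>m n k" if "\<forall>Z \<in> GL_orbit k Y. A * Z = 0\<^sub>m n k"
    using that by blast
  show "\<forall>Z \<in> GL_orbit k Y. A * Z = 0\<^sub>m n k" if "A * Y = 0\<^sub>m n k"
  proof
    fix Z assume "Z \<in> GL_orbit k Y"
    then obtain G where G: "G \<in> carrier_mat k k" "Z = Y * G"
      by (auto simp: GL_orbit_def GL_mat_def)
    then have "A * Z = A * Y * G"
      using assms(1) Y by (simp add: assoc_mult_mat)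
    then show "A * Z = 0\<^sub>m n k"
      using that G by simp
  qed
qed

end

theory Submission
  imports Defs "Jordan_Normal_Form.DL_Rank_Submatrix"
begin

text \<open>
  Put \<open>k = m - r\<close>.  Over the domain of the standard chart of the Grassmannian given by a set \<open>J\<close> of
  \<open>k\<close> row indices, every class has exactly one representative \<open>Y\<close> whose rows in \<open>J\<close> form the
  identity matrix; the remaining \<open>r\<close> rows form the \<open>r \<times> k\<close> matrix \<open>X\<close> of chart coordinates.  Write
  \<open>A\<^sub>J\<close> and \<open>A\<^sub>J\<^sub>c\<close> for the columns of \<open>A\<close> inside and outside \<open>J\<close>.  Then
  \<open>A Y = A\<^sub>J + A\<^sub>J\<^sub>c X\<close>, so the equation \<open>A Y = 0\<close> can be solved for \<open>A\<^sub>J\<close>.  Replacing the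
  coordinates \<open>A\<^sub>J\<close> by \<open>B = A\<^sub>J + A\<^sub>J\<^sub>c X\<close> is a polynomial bijection of the coordinate space with
  polynomial inverse \<open>A\<^sub>J = B - A\<^sub>J\<^sub>c X\<close>, and in the coordinates \<open>(A\<^sub>J\<^sub>c, X, B)\<close> the set of pairs is
  \<open>B = 0\<close>.  The free coordinates \<open>(A\<^sub>J\<^sub>c, X)\<close> number \<open>n r + r k = (n + m) r - r\<^sup>2\<close>.  This is
  \<open>slice_chart_in_slice_iff\<close>.

  It remains to see that the ambient product is a smooth manifold and that the new coordinates
  belong to its maximal atlas.  All coordinate changes that occur are rational functions without
  poles.  These form a class closed under partial derivatives and consisting of continuous
  functions, hence they are smooth (\<open>rational_on_imp_C_k_on\<close>); since the class is also closed under
  composition, the chain rule for \<open>C\<^sup>k\<close> functions is avoided.  Moreover every chart that occurs maps onto the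
  whole coordinate space.  Manifolds with a finite atlas of such charts (\<open>rational_manifold\<close>) are
  stable under products, and composing one of their charts with a rational bijection of the
  coordinate space stays in the maximal atlas
  (\<open>rational_reparametrization_in_maximal_atlas\<close>).

  Two properties of the Grassmannian need an argument of their own.  The charts cover it
  because a matrix \<open>Y\<close> of full column rank has a nonzero maximal minor: \<open>Y\<^sup>T Y\<close> is invertible, and by
  multilinearity its determinant is a combination of maximal minors of \<open>Y\<close>
  (\<open>stiefel_imp_minor_nonzero\<close>).  It is Hausdorff because two classes either lie in a
  common chart or are separated by a continuous function, the square of one maximal minor
  divided by the sum of the squares of all of them (\<open>class_minor_ratio\<close>).
\<close>

section \<open>Rational functions\<close>

text \<open>
  The functions on \<open>W\<close> obtained from the coordinates by field operations.  Rule \<open>cong\<close> makes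
  the notion depend only on the values on \<open>W\<close>.
\<close>

inductive rational_on :: "nat \<Rightarrow> (nat \<Rightarrow> real) set \<Rightarrow> ((nat \<Rightarrow> real) \<Rightarrow> real) \<Rightarrow> bool"
  for d W where
  const: "rational_on d W (\<lambda>_. a)"
| coord: "i < d \<Longrightarrow> rational_on d W (\<lambda>x. x i)"
| add: "rational_on d W f \<Longrightarrow> rational_on d W g \<Longrightarrow> rational_on d W (\<lambda>x. f x + g x)"
| mult: "rational_on d W f \<Longrightarrow> rational_on d W g \<Longrightarrow> rational_on d W (\<lambda>x. f x * g x)"
| inverse: "rational_on d W f \<Longrightarrow> \<forall>x\<in>W. f x \<noteq> 0 \<Longrightarrow> rational_on d W (\<lambda>x. inverse (f x))"
| cong: "rational_on d W f \<Longrightarrow> \<forall>x\<in>W. f x = g x \<Longrightarrow> rational_on d W g"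

text \<open>
  All rules but \<open>cong\<close>, whose conclusion matches its own premise, so that repeated backward
  application does not end.
\<close>

lemmas rational_on_intros =
  rational_on.const rational_on.coord rational_on.add rational_on.mult rational_on.inverse

lemma rational_on_sum:
  assumes "\<And>i. i \<in> I \<Longrightarrow> rational_on d W (f i)"
  shows "rational_on d W (\<lambda>x. \<Sum>i\<in>I. f i x)"
  using assms by (induction I rule: infinite_finite_induct) (auto intro: rational_on_intros)

lemma rational_on_prod:
  assumes "\<And>i. i \<in> I \<Longrightarrow> rational_on d W (f i)"
  shows "rational_on d W (\<lambda>x. \<Prod>i\<in>I. f i x)"
  using assms by (induction I rule: infinite_finite_induct) (auto intro: rational_on_intros)

lemma rational_on_diff:
  assumes "rational_on d W f" "rational_on d W g"
  shows "rational_on d W (\<lambda>x. f x - g x)"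
  using rational_on.add [OF assms(1) rational_on.mult [OF rational_on.const [of d W "- 1"] assms(2)]]
  by simp

lemma rational_on_divide:
  assumes "rational_on d W f" "rational_on d W g" "\<forall>x\<in>W. g x \<noteq> 0"
  shows "rational_on d W (\<lambda>x. f x / g x)"
  using rational_on.mult [OF assms(1) rational_on.inverse [OF assms(2,3)]]
  by (simp add: divide_inverse)

lemma rational_on_compose:
  assumes "rational_on e V g" and "\<And>j. j < e \<Longrightarrow> rational_on d W (\<lambda>x. F x j)"
    and "\<And>x. x \<in> W \<Longrightarrow> F x \<in> V"
  shows "rational_on d W (\<lambda>x. g (F x))"
  using assms(1)
proof induction
  case (cong f g)
  show ?case
    by (rule rational_on.cong [OF cong.IH]) (use cong.hyps assms(3) in auto)
next
  case (inverse f)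
  show ?case
    by (rule rational_on.inverse [OF inverse.IH]) (use inverse.hyps assms(3) in auto)
qed (auto intro: rational_on_intros assms(2))

lemma rational_on_imp_continuous_map:
  assumes "rational_on d W f"
  shows "continuous_map (subtopology (Euclidean_space d) W) euclideanreal f"
  using assms
proof induction
  case (coord i)
  have "continuous_map (powertop_real UNIV) euclideanreal (\<lambda>x. x i)"
    by (rule continuous_map_product_projection) simp
  then show ?case
    unfolding Euclidean_space_def by (intro continuous_map_from_subtopology)
next
  case (cong f g)
  show ?case
    by (rule continuous_map_eq [OF cong.IH]) (use cong.hyps in auto)
qed (auto intro!: continuous_intros)

text \<open>
  Partial derivatives are taken along the line \<open>x(i := t)\<close>, which is not confined to \<open>W\<close>.  As \<open>W\<close> is
  open, the line stays in \<open>W\<close> near \<open>t = x i\<close>, so values outside \<open>W\<close> do not affect the derivative.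
\<close>

lemma eventually_fun_upd_in_open:
  assumes "openin (Euclidean_space d) W" "x \<in> W" "i < d"
  shows "\<forall>\<^sub>F t in at (x i). x(i := t) \<in> W"
proof -
  have x: "x \<in> topspace (Euclidean_space d)"
    using assms openin_subset by blast
  have "continuous_map euclideanreal (Euclidean_space d) (\<lambda>t. x(i := t))"
    unfolding Euclidean_space_def continuous_map_in_subtopology continuous_map_componentwise_UNIV
    using x \<open>i < d\<close> by (auto simp: topspace_Euclidean_space)
  then have "openin euclideanreal {t \<in> topspace euclideanreal. x(i := t) \<in> W}"
    using assms(1) openin_continuous_map_preimage by blast
  then have "open {t. x(i := t) \<in> W}"
    by simp
  then have "\<forall>\<^sub>F t in nhds (x i). t \<in> {t. x(i := t) \<in> W}"
    by (rule eventually_nhds_in_open) (use assms in simp)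
  then show ?thesis
    unfolding eventually_at_filter by (rule eventually_mono) simp
qed

text \<open>
  The sum, product and quotient rules express the derivative by field operations again.
\<close>

lemma rational_on_partial_derivative:
  assumes "rational_on d W f" and "openin (Euclidean_space d) W" and "i < d"
  shows "\<exists>g. rational_on d W g \<and>
             (\<forall>x\<in>W. ((\<lambda>t. f (x(i := t))) has_real_derivative g x) (at (x i)))"
  using assms(1)
proof induction
  case (const a)
  show ?case
    by (intro exI [of _ "\<lambda>_. 0"] conjI rational_on.const) auto
next
  case (coord j)
  show ?case
    by (intro exI [of _ "\<lambda>_. if i = j then 1 else 0"] conjI rational_on.const) auto
next
  case (add f g)
  then obtain f' g' where *: "rational_on d W f'" "rational_on d W g'"
    "\<forall>x\<in>W. ((\<lambda>t. f (x(i := t))) has_real_derivative f' x) (at (x i))"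
    "\<forall>x\<in>W. ((\<lambda>t. g (x(i := t))) has_real_derivative g' x) (at (x i))"
    by blast
  have der: "((\<lambda>t. f (x(i := t)) + g (x(i := t))) has_real_derivative f' x + g' x) (at (x i))"
    if "x \<in> W" for x
    using DERIV_add [OF bspec [OF *(3) that] bspec [OF *(4) that]] .
  show ?case
    by (rule exI, rule conjI, rule rational_on.add [OF *(1,2)], rule ballI, rule der)
next
  case (mult f g)
  then obtain f' g' where *: "rational_on d W f'" "rational_on d W g'"
    "\<forall>x\<in>W. ((\<lambda>t. f (x(i := t))) has_real_derivative f' x) (at (x i))"
    "\<forall>x\<in>W. ((\<lambda>t. g (x(i := t))) has_real_derivative g' x) (at (x i))"
    by blast
  have der: "((\<lambda>t. f (x(i := t)) * g (x(i := t))) has_real_derivative f' x * g x + g' x * f x) (at (x i))"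
    if "x \<in> W" for x
    using DERIV_mult [OF bspec [OF *(3) that] bspec [OF *(4) that]] by simp
  have r: "rational_on d W (\<lambda>x. f' x * g x + g' x * f x)"
    using * mult.hyps by (intro rational_on.add rational_on.mult)
  show ?case
    by (rule exI, rule conjI, rule r, rule ballI, rule der)
next
  case (inverse f)
  then obtain f' where *: "rational_on d W f'"
    "\<forall>x\<in>W. ((\<lambda>t. f (x(i := t))) has_real_derivative f' x) (at (x i))"
    by blast
  have der: "((\<lambda>t. inverse (f (x(i := t)))) has_real_derivative
          (-1) * (inverse (f x) * f' x * inverse (f x))) (at (x i))"
    if "x \<in> W" for x
    using DERIV_inverse' [OF bspec [OF *(2) that]] inverse.hyps that by simp
  have r: "rational_on d W (\<lambda>x. (-1) * (inverse (f x) * f' x * inverse (f x)))"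
    using * inverse.hyps by (intro rational_on.mult rational_on.const rational_on.inverse)
  show ?case
    by (rule exI, rule conjI, rule r, rule ballI, rule der)
next
  case (cong f g)
  then obtain f' where *: "rational_on d W f'"
    "\<forall>x\<in>W. ((\<lambda>t. f (x(i := t))) has_real_derivative f' x) (at (x i))"
    by blast
  have der: "((\<lambda>t. g (x(i := t))) has_real_derivative f' x) (at (x i))" if "x \<in> W" for x
  proof -
    have "\<forall>\<^sub>F t in nhds (x i). f (x(i := t)) = g (x(i := t))"
    proof (rule eventually_mono)
      show "\<forall>\<^sub>F t in nhds (x i). t \<noteq> x i \<longrightarrow> t \<in> UNIV \<longrightarrow> x(i := t) \<in> W"
        using eventually_fun_upd_in_open [OF assms(2) that assms(3)]
        unfolding eventually_at_filter .
      show "f (x(i := t)) = g (x(i := t))" if "t \<noteq> x i \<longrightarrow> t \<in> UNIV \<longrightarrow> x(i := t) \<in> W" for t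
        using that cong.hyps \<open>x \<in> W\<close> by (cases "t = x i") auto
    qed
    then have "((\<lambda>t. f (x(i := t))) has_real_derivative f' x) (at (x i)) \<longleftrightarrow>
        ((\<lambda>t. g (x(i := t))) has_real_derivative f' x) (at (x i))"
      by (intro DERIV_cong_ev refl)
    then show ?thesis
      by (rule iffD1) (rule bspec [OF *(2) that])
  qed
  show ?case
    by (rule exI, rule conjI, rule *(1), rule ballI, rule der)
qed

text \<open>
  Continuity together with closure under partial derivatives gives every order of
  differentiability by induction.
\<close>

lemma rational_on_imp_C_k_on:
  assumes "rational_on d W f" and "openin (Euclidean_space d) W"
  shows "C_k_on k d W f"
  using assms(1)
proof (induction k arbitrary: f)
  case 0
  then show ?case
    by (simp add: rational_on_imp_continuous_map)
next
  case (Suc k)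
  have "\<exists>g. (\<forall>x\<in>W. ((\<lambda>t. f (x(i := t))) has_real_derivative g x) (at (x i))) \<and> C_k_on k d W g"
    if "i < d" for i
    using rational_on_partial_derivative [OF Suc.prems assms(2) that] Suc.IH by blast
  then show ?case
    using Suc.prems by (simp add: rational_on_imp_continuous_map)
qed


definition rational_map ::
  "nat \<Rightarrow> (nat \<Rightarrow> real) set \<Rightarrow> nat \<Rightarrow> ((nat \<Rightarrow> real) \<Rightarrow> nat \<Rightarrow> real) \<Rightarrow> bool" where
  "rational_map d W e F \<longleftrightarrow>
     (\<forall>j<e. rational_on d W (\<lambda>x. F x j)) \<and> F ` W \<subseteq> topspace (Euclidean_space e)"

lemma rational_map_compose:
  assumes "rational_map e V e' G" "rational_map d W e F" "F ` W \<subseteq> V"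
  shows "rational_map d W e' (G \<circ> F)"
  unfolding rational_map_def
proof (intro conjI allI impI)
  fix j assume "j < e'"
  then show "rational_on d W (\<lambda>x. (G \<circ> F) x j)"
    using rational_on_compose [of e V "\<lambda>y. G y j" d W F] assms
    by (simp add: rational_map_def image_subset_iff)
qed (use assms in \<open>simp add: rational_map_def image_subset_iff\<close>)

lemma rational_map_cong:
  assumes "rational_map d W e F" "\<And>x. x \<in> W \<Longrightarrow> F x = G x"
  shows "rational_map d W e G"
  unfolding rational_map_def
proof (intro conjI allI impI)
  fix j assume "j < e"
  then show "rational_on d W (\<lambda>x. G x j)"
    using assms rational_on.cong [of d W "\<lambda>x. F x j" "\<lambda>x. G x j"] by (simp add: rational_map_def)
qed (use assms in \<open>auto simp: rational_map_def\<close>)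

lemma rational_map_id:
  assumes "W \<subseteq> topspace (Euclidean_space d)"
  shows "rational_map d W d (\<lambda>x. x)"
  using assms by (auto simp: rational_map_def intro: rational_on.coord)

lemma rational_map_mono:
  assumes "rational_map d V e F" "W \<subseteq> V" "W \<subseteq> topspace (Euclidean_space d)"
  shows "rational_map d W e F"
  using rational_map_compose [OF assms(1) rational_map_id [OF assms(3)]] assms(2)
  by (simp add: comp_def)

lemma rational_map_imp_smooth_map_on:
  "rational_map d W e F \<Longrightarrow> openin (Euclidean_space d) W \<Longrightarrow> smooth_map_on d e W F"
  by (simp add: rational_map_def smooth_map_on_def rational_on_imp_C_k_on)

lemma rational_map_imp_continuous_map:
  assumes "rational_map d W e F" "W \<subseteq> topspace (Euclidean_space d)"
  shows "continuous_map (subtopology (Euclidean_space d) W) (Euclidean_space e) F"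
proof -
  have "continuous_map (subtopology (Euclidean_space d) W) euclideanreal (\<lambda>x. F x j)" for j
  proof (cases "j < e")
    case True
    then show ?thesis
      using assms by (simp add: rational_map_def rational_on_imp_continuous_map)
  next
    case False
    then have "F x j = 0" if "x \<in> W" for x
      using assms that by (auto simp: rational_map_def topspace_Euclidean_space image_subset_iff)
    then show ?thesis
      by (intro continuous_map_eq [of _ _ "\<lambda>_. 0" "\<lambda>x. F x j"]) simp_all
  qed
  then show ?thesis
    using assms unfolding Euclidean_space_def [of e] continuous_map_in_subtopology
      continuous_map_componentwise_UNIV
    by (simp add: rational_map_def topspace_Euclidean_space Pi_iff image_subset_iff)
qed


section \<open>Coordinates: concatenation and matrices\<close>

text \<open>
  Products of charts concatenate coordinate vectors.  Vectors in \<open>\<real>\<^sup>d\<close> are sequences vanishing from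
  \<open>d\<close> on, so the first part is cut off at \<open>d\<close> while the second part is only shifted.
\<close>

definition join_coords :: "nat \<Rightarrow> (nat \<Rightarrow> real) \<Rightarrow> (nat \<Rightarrow> real) \<Rightarrow> nat \<Rightarrow> real" where
  "join_coords d x y = (\<lambda>i. if i < d then x i else y (i - d))"

definition take_coords :: "nat \<Rightarrow> (nat \<Rightarrow> real) \<Rightarrow> nat \<Rightarrow> real" where
  "take_coords d x = (\<lambda>i. if i < d then x i else 0)"

definition drop_coords :: "nat \<Rightarrow> (nat \<Rightarrow> real) \<Rightarrow> nat \<Rightarrow> real" where
  "drop_coords d x = (\<lambda>i. x (i + d))"

lemma join_coords_take_drop [simp]: "join_coords d (take_coords d x) (drop_coords d x) = x"
  by (auto simp: join_coords_def take_coords_def drop_coords_def)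

lemma take_join_coords [simp]:
  "x \<in> topspace (Euclidean_space d) \<Longrightarrow> take_coords d (join_coords d x y) = x"
  by (auto simp: join_coords_def take_coords_def topspace_Euclidean_space)

lemma drop_join_coords [simp]: "drop_coords d (join_coords d x y) = y"
  by (auto simp: join_coords_def drop_coords_def)

lemma join_coords_in_Euclidean_space:
  "y \<in> topspace (Euclidean_space e) \<Longrightarrow> join_coords d x y \<in> topspace (Euclidean_space (d + e))"
  by (auto simp: join_coords_def topspace_Euclidean_space)

lemma take_coords_in_Euclidean_space: "take_coords d x \<in> topspace (Euclidean_space d)"
  by (auto simp: take_coords_def topspace_Euclidean_space)

lemma drop_coords_in_Euclidean_space:
  "x \<in> topspace (Euclidean_space (d + e)) \<Longrightarrow> drop_coords d x \<in> topspace (Euclidean_space e)"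
  by (auto simp: drop_coords_def topspace_Euclidean_space)

lemma rational_map_join_coords:
  assumes "rational_map c W d F" "rational_map c W e G"
  shows "rational_map c W (d + e) (\<lambda>x. join_coords d (F x) (G x))"
proof -
  have "rational_on c W (\<lambda>x. join_coords d (F x) (G x) j)" if "j < d + e" for j
    using assms that by (cases "j < d") (auto simp: rational_map_def join_coords_def)
  then show ?thesis
    using assms by (auto simp: rational_map_def image_subset_iff intro: join_coords_in_Euclidean_space)
qed

lemma rational_map_take_coords:
  assumes "W \<subseteq> topspace (Euclidean_space (d + e))"
  shows "rational_map (d + e) W d (take_coords d)"
  unfolding rational_map_def
proof (intro conjI allI impI)
  fix j assume "j < d"
  then show "rational_on (d + e) W (\<lambda>x. take_coords d x j)"
    using rational_on.coord [of j "d + e" W] by (simp add: take_coords_def)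
qed (use assms take_coords_in_Euclidean_space in blast)

lemma rational_map_drop_coords:
  assumes "W \<subseteq> topspace (Euclidean_space (d + e))"
  shows "rational_map (d + e) W e (drop_coords d)"
  unfolding rational_map_def
proof (intro conjI allI impI)
  fix j assume "j < e"
  then show "rational_on (d + e) W (\<lambda>x. drop_coords d x j)"
    using rational_on.coord [of "j + d" "d + e" W] by (simp add: drop_coords_def)
qed (use assms drop_coords_in_Euclidean_space in blast)

lemma rational_map_take_coords_comp:
  "rational_map c W (d + e) F \<Longrightarrow> rational_map c W d (\<lambda>x. take_coords d (F x))"
  using rational_map_compose [OF rational_map_take_coords [OF subset_refl], of c W d e F]
  by (simp add: rational_map_def comp_def)

lemma rational_map_drop_coords_comp:
  "rational_map c W (d + e) F \<Longrightarrow> rational_map c W e (\<lambda>x. drop_coords d (F x))"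
  using rational_map_compose [OF rational_map_drop_coords [OF subset_refl], of c W d e F]
  by (simp add: rational_map_def comp_def)

lemma homeomorphic_maps_join_coords:
  "homeomorphic_maps (prod_topology (Euclidean_space d) (Euclidean_space e)) (Euclidean_space (d + e))
     (\<lambda>(x, y). join_coords d x y) (\<lambda>x. (take_coords d x, drop_coords d x))"
proof -
  let ?X = "prod_topology (Euclidean_space d) (Euclidean_space e)"
  have coord: "continuous_map (Euclidean_space c) euclideanreal (\<lambda>x. x i)" for c i
    unfolding Euclidean_space_def
    by (intro continuous_map_from_subtopology continuous_map_product_projection) simp
  have "continuous_map ?X euclideanreal ((\<lambda>x. x i) \<circ> fst)"
       "continuous_map ?X euclideanreal ((\<lambda>x. x (i - d)) \<circ> snd)" for i
    by (rule continuous_map_compose [OF continuous_map_fst coord]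
             continuous_map_compose [OF continuous_map_snd coord])+
  then have "continuous_map ?X euclideanreal (\<lambda>z. join_coords d (fst z) (snd z) i)" for i
    by (cases "i < d") (simp_all add: join_coords_def comp_def)
  then have "continuous_map ?X (Euclidean_space (d + e)) (\<lambda>(x, y). join_coords d x y)"
    unfolding Euclidean_space_def [of "d + e"] continuous_map_in_subtopology
      continuous_map_componentwise_UNIV
    using join_coords_in_Euclidean_space [of _ e d]
    by (auto simp: case_prod_beta topspace_Euclidean_space image_subset_iff)
  moreover have "continuous_map (Euclidean_space (d + e)) (Euclidean_space d) (take_coords d)"
    "continuous_map (Euclidean_space (d + e)) (Euclidean_space e) (drop_coords d)"
    using rational_map_imp_continuous_map [OF rational_map_take_coords [OF subset_refl, of d e]]
      rational_map_imp_continuous_map [OF rational_map_drop_coords [OF subset_refl, of d e]]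
    by simp_all
  ultimately show ?thesis
    by (auto simp: homeomorphic_maps_def continuous_map_pairwise comp_def)
qed


section \<open>Manifolds with a finite atlas of rational transitions\<close>

text \<open>
  A chart onto the whole coordinate space.  Its inverse is then defined everywhere, and composing
  it with a bijection of the coordinate space gives a chart of the same kind.
\<close>

definition full_chart :: "nat \<Rightarrow> 'a topology \<Rightarrow> 'a chart \<Rightarrow> bool" where
  "full_chart d X = (\<lambda>(U, \<phi>).
     openin X U \<and> homeomorphic_map (subtopology X U) (Euclidean_space d) \<phi>)"

definition rational_transition :: "nat \<Rightarrow> 'a chart \<Rightarrow> 'a chart \<Rightarrow> bool" where
  "rational_transition d = (\<lambda>(U, \<phi>) (V, \<psi>).
     rational_map d (\<phi> ` (U \<inter> V)) d (\<psi> \<circ> inv_into U \<phi>))"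

text \<open>
  Second countability is not demanded, since it follows from finiteness of the atlas.
\<close>

definition rational_manifold :: "'a manifold \<Rightarrow> bool" where
  "rational_manifold M \<longleftrightarrow>
     Hausdorff_space (mfd_top M) \<and> finite (mfd_atlas M) \<and>
     (\<forall>c \<in> mfd_atlas M. full_chart (mfd_dim M) (mfd_top M) c) \<and>
     (\<Union>(U, \<phi>) \<in> mfd_atlas M. U) = topspace (mfd_top M) \<and>
     (\<forall>c \<in> mfd_atlas M. \<forall>c' \<in> mfd_atlas M. rational_transition (mfd_dim M) c c')"

lemma full_chart_image:
  assumes "full_chart d X (U, \<phi>)"
  shows "\<phi> ` U = topspace (Euclidean_space d)"
  using assms homeomorphic_imp_surjective_map
  by (fastforce simp: full_chart_def topspace_subtopology dest: openin_subset)

lemma full_chart_inj_on: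
  assumes "full_chart d X (U, \<phi>)"
  shows "inj_on \<phi> U"
  using assms homeomorphic_imp_injective_map [of "subtopology X U" "Euclidean_space d" \<phi>]
  by (auto simp: full_chart_def Int_absorb1 dest: openin_subset)

lemma full_chart_imp_chart_on:
  assumes "full_chart d X c"
  shows "chart_on d X c"
proof -
  obtain U \<phi> where c: "c = (U, \<phi>)"
    by fastforce
  show ?thesis
    using assms full_chart_image [of d X U \<phi>] unfolding c
    by (simp add: chart_on_def full_chart_def)
qed

lemma rational_imp_smooth_transition:
  assumes "full_chart d X c" "full_chart d X c'" "rational_transition d c c'"
  shows "smooth_transition d c c'"
proof -
  obtain U \<phi> V \<psi> where c: "c = (U, \<phi>)" "c' = (V, \<psi>)"
    by fastforce
  have "openin X U" "openin X V" "open_map (subtopology X U) (Euclidean_space d) \<phi>"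
    using assms by (auto simp: c full_chart_def homeomorphic_imp_open_map)
  then have "openin (Euclidean_space d) (\<phi> ` (U \<inter> V))"
    by (auto simp: open_map_def openin_open_subtopology)
  then show ?thesis
    using assms(3) by (simp add: c rational_transition_def smooth_transition_def
        rational_map_imp_smooth_map_on)
qed

lemma second_countable_Euclidean_space: "second_countable (Euclidean_space d)"
proof -
  obtain \<B> :: "(nat \<Rightarrow> real) set set" where "countable \<B>" "topological_basis \<B>"
    using ex_countable_basis by blast
  then have "second_countable (euclidean :: (nat \<Rightarrow> real) topology)"
    unfolding second_countable_def open_openin [symmetric]
    by (metis topological_basisE topological_basis_open)
  then show ?thesis
    by (simp add: Euclidean_space_def euclidean_product_topology second_countable_subtopology)
qed

lemma second_countable_finite_open_cover:
  assumes "finite \<U>" and "topspace X \<subseteq> \<Union>\<U>"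
    and "\<And>U. U \<in> \<U> \<Longrightarrow> openin X U \<and> second_countable (subtopology X U)"
  shows "second_countable X"
proof -
  have "\<exists>\<B>. countable \<B> \<and> (\<forall>V\<in>\<B>. openin (subtopology X U) V) \<and>
          (\<forall>W x. openin (subtopology X U) W \<and> x \<in> W \<longrightarrow> (\<exists>V\<in>\<B>. x \<in> V \<and> V \<subseteq> W))"
    if "U \<in> \<U>" for U
    using assms(3) [OF that] by (simp add: second_countable_def)
  then obtain \<B> where \<B>: "\<And>U. U \<in> \<U> \<Longrightarrow> countable (\<B> U)"
    "\<And>U V. U \<in> \<U> \<Longrightarrow> V \<in> \<B> U \<Longrightarrow> openin (subtopology X U) V"
    "\<And>U W x. U \<in> \<U> \<Longrightarrow> openin (subtopology X U) W \<Longrightarrow> x \<in> W \<Longrightarrow> \<exists>V\<in>\<B> U. x \<in> V \<and> V \<subseteq> W"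
    by metis
  show ?thesis
    unfolding second_countable_def
  proof (intro exI [of _ "\<Union>U\<in>\<U>. \<B> U"] conjI ballI allI impI)
    show "countable (\<Union>U\<in>\<U>. \<B> U)"
      using \<B>(1) assms(1) by (auto intro: countable_finite)
  next
    fix V assume "V \<in> (\<Union>U\<in>\<U>. \<B> U)"
    then show "openin X V"
      using \<B>(2) assms(3) by (auto simp: openin_open_subtopology)
  next
    fix W x assume W: "openin X W \<and> x \<in> W"
    then obtain U where U: "U \<in> \<U>" "x \<in> U"
      using assms(2) openin_subset by blast
    then have "openin (subtopology X U) (U \<inter> W)" "x \<in> U \<inter> W"
      using W assms(3) [OF U(1)] by (auto simp: openin_open_subtopology)
    then obtain V where "V \<in> \<B> U" "x \<in> V" "V \<subseteq> U \<inter> W"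
      using \<B>(3) [OF U(1)] by blast
    then show "\<exists>V\<in>\<Union>U\<in>\<U>. \<B> U. x \<in> V \<and> V \<subseteq> W"
      using U by blast
  qed
qed

lemma rational_manifold_imp_smooth_manifold:
  assumes "rational_manifold M"
  shows "smooth_manifold M"
proof -
  have "second_countable (subtopology (mfd_top M) U)" "openin (mfd_top M) U"
    if "(U, \<phi>) \<in> mfd_atlas M" for U \<phi>
  proof -
    have *: "full_chart (mfd_dim M) (mfd_top M) (U, \<phi>)"
      using assms that by (auto simp: rational_manifold_def)
    then show "openin (mfd_top M) U"
      by (simp add: full_chart_def)
    have "subtopology (mfd_top M) U homeomorphic_space Euclidean_space (mfd_dim M)"
      using * by (auto simp: full_chart_def intro: homeomorphic_map_imp_homeomorphic_space)
    then show "second_countable (subtopology (mfd_top M) U)"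
      using homeomorphic_space_second_countability second_countable_Euclidean_space by blast
  qed
  moreover have "topspace (mfd_top M) \<subseteq> \<Union>(fst ` mfd_atlas M)" "finite (fst ` mfd_atlas M)"
    using assms by (simp_all add: rational_manifold_def case_prod_beta)
  ultimately have "second_countable (mfd_top M)"
    by (intro second_countable_finite_open_cover [of "fst ` mfd_atlas M"]) auto
  then show ?thesis
    using assms unfolding rational_manifold_def smooth_manifold_def compatible_charts_def
    by (blast intro: full_chart_imp_chart_on rational_imp_smooth_transition)
qed

lemma prod_chart_eq:
  "prod_chart d (U, \<phi>) (V, \<psi>) = (U \<times> V, \<lambda>(x, y). join_coords d (\<phi> x) (\<psi> y))"
  by (auto simp: prod_chart_def join_coords_def)

lemma full_chart_prod:
  assumes "full_chart d X c" and "full_chart e Y c'"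
  shows "full_chart (d + e) (prod_topology X Y) (prod_chart d c c')"
proof -
  obtain U \<phi> V \<psi> where c: "c = (U, \<phi>)" "c' = (V, \<psi>)"
    by fastforce
  obtain \<phi>' \<psi>' where
    "homeomorphic_maps (subtopology X U) (Euclidean_space d) \<phi> \<phi>'"
    "homeomorphic_maps (subtopology Y V) (Euclidean_space e) \<psi> \<psi>'"
    using assms by (auto simp: c full_chart_def homeomorphic_map_maps)
  then have "homeomorphic_maps (subtopology (prod_topology X Y) (U \<times> V))
      (prod_topology (Euclidean_space d) (Euclidean_space e))
      (\<lambda>(x, y). (\<phi> x, \<psi> y)) (\<lambda>(x, y). (\<phi>' x, \<psi>' y))"
    by (simp add: subtopology_Times homeomorphic_maps_prod)
  then have "homeomorphic_map (subtopology (prod_topology X Y) (U \<times> V)) (Euclidean_space (d + e))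
      ((\<lambda>(x, y). join_coords d x y) \<circ> (\<lambda>(x, y). (\<phi> x, \<psi> y)))"
    using homeomorphic_maps_compose homeomorphic_maps_join_coords homeomorphic_map_maps by blast
  then show ?thesis
    using assms by (simp add: c full_chart_def prod_chart_eq openin_prod_Times_iff comp_def
        case_prod_beta')
qed

text \<open>
  The transition map of product charts acts separately on the two blocks of coordinates; on the
  relevant set it is the concatenation of the two given transition maps.
\<close>

lemma rational_transition_prod:
  assumes "full_chart d X c1" "full_chart e Y c2"
    and "full_chart d X c1'" "full_chart e Y c2'"
    and "rational_transition d c1 c1'" "rational_transition e c2 c2'"
  shows "rational_transition (d + e) (prod_chart d c1 c2) (prod_chart d c1' c2')"
proof -
  obtain U \<phi> V \<psi> U' \<phi>' V' \<psi>'
    where c: "c1 = (U, \<phi>)" "c2 = (V, \<psi>)" "c1' = (U', \<phi>')" "c2' = (V', \<psi>')"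
    by fastforce
  let ?\<Phi> = "\<lambda>(x, y). join_coords d (\<phi> x) (\<psi> y)"
  let ?\<Phi>' = "\<lambda>(x, y). join_coords d (\<phi>' x) (\<psi>' y)"
  let ?W = "?\<Phi> ` ((U \<times> V) \<inter> (U' \<times> V'))"
  let ?\<tau> = "\<phi>' \<circ> inv_into U \<phi>" and ?\<sigma> = "\<psi>' \<circ> inv_into V \<psi>"
  have inj: "inj_on \<phi> U" "inj_on \<psi> V"
    using assms c full_chart_inj_on by blast+
  have \<phi>: "\<phi> x \<in> topspace (Euclidean_space d)" if "x \<in> U" for x
    using full_chart_image assms(1) that unfolding c by blast
  have \<psi>: "\<psi> y \<in> topspace (Euclidean_space e)" if "y \<in> V" for y
    using full_chart_image assms(2) that unfolding c by blast
  have inj_prod: "inj_on ?\<Phi> (U \<times> V)"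
  proof (rule inj_onI; clarify)
    fix x y x' y'
    assume *: "x \<in> U" "y \<in> V" "x' \<in> U" "y' \<in> V"
      "join_coords d (\<phi> x) (\<psi> y) = join_coords d (\<phi> x') (\<psi> y')"
    then have "\<phi> x = \<phi> x'" "\<psi> y = \<psi> y'"
      using take_join_coords [OF \<phi>] drop_join_coords by metis+
    with * inj show "x = x' \<and> y = y'"
      by (auto dest: inj_onD)
  qed
  have W: "?W \<subseteq> topspace (Euclidean_space (d + e))"
    using \<psi> join_coords_in_Euclidean_space by fastforce
  have "rational_map (d + e) ?W d (?\<tau> \<circ> take_coords d)"
    by (rule rational_map_compose [OF _ rational_map_take_coords [OF W]])
       (use assms(5) \<phi> in \<open>auto simp: c rational_transition_def\<close>)
  moreover have "rational_map (d + e) ?W e (?\<sigma> \<circ> drop_coords d)"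
    by (rule rational_map_compose [OF _ rational_map_drop_coords [OF W]])
       (use assms(6) in \<open>auto simp: c rational_transition_def\<close>)
  ultimately have "rational_map (d + e) ?W (d + e)
      (\<lambda>z. join_coords d ((?\<tau> \<circ> take_coords d) z) ((?\<sigma> \<circ> drop_coords d) z))"
    by (rule rational_map_join_coords)
  moreover have "join_coords d ((?\<tau> \<circ> take_coords d) z) ((?\<sigma> \<circ> drop_coords d) z) =
      (?\<Phi>' \<circ> inv_into (U \<times> V) ?\<Phi>) z" if "z \<in> ?W" for z
  proof -
    obtain p where "p \<in> (U \<times> V) \<inter> (U' \<times> V')" "z = ?\<Phi> p"
      using \<open>z \<in> ?W\<close> by (rule imageE)
    moreover obtain x y where "p = (x, y)"
      by (cases p)
    ultimately have xy: "x \<in> U" "x \<in> U'" "y \<in> V" "y \<in> V'" and z: "z = ?\<Phi> (x, y)"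
      by simp_all
    have "inv_into (U \<times> V) ?\<Phi> z = (x, y)"
      unfolding z using inj_prod xy by (intro inv_into_f_f) auto
    then show ?thesis
      using xy inj \<phi> by (simp add: z inv_into_f_f)
  qed
  ultimately have "rational_map (d + e) ?W (d + e) (?\<Phi>' \<circ> inv_into (U \<times> V) ?\<Phi>)"
    by (rule rational_map_cong)
  then show ?thesis
    by (simp add: c prod_chart_eq rational_transition_def)
qed

lemma rational_manifold_prod:
  assumes "rational_manifold M" and "rational_manifold N"
  shows "rational_manifold (prod_manifold M N)"
proof -
  let ?d = "mfd_dim M" and ?e = "mfd_dim N"
  let ?P = "prod_chart ?d"
  have atlas: "mfd_atlas (prod_manifold M N) = (\<lambda>(c, c'). ?P c c') ` (mfd_atlas M \<times> mfd_atlas N)"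
    by (auto simp: prod_manifold_def)
  have M: "\<And>c. c \<in> mfd_atlas M \<Longrightarrow> full_chart ?d (mfd_top M) c"
    "\<And>c c'. c \<in> mfd_atlas M \<Longrightarrow> c' \<in> mfd_atlas M \<Longrightarrow> rational_transition ?d c c'"
    "(\<Union>(U, \<phi>) \<in> mfd_atlas M. U) = topspace (mfd_top M)"
    using assms(1) by (auto simp: rational_manifold_def)
  have N: "\<And>c. c \<in> mfd_atlas N \<Longrightarrow> full_chart ?e (mfd_top N) c"
    "\<And>c c'. c \<in> mfd_atlas N \<Longrightarrow> c' \<in> mfd_atlas N \<Longrightarrow> rational_transition ?e c c'"
    "(\<Union>(U, \<phi>) \<in> mfd_atlas N. U) = topspace (mfd_top N)"
    using assms(2) by (auto simp: rational_manifold_def)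
  have "(\<Union>(W, \<Phi>) \<in> mfd_atlas (prod_manifold M N). W) =
      (\<Union>(U, \<phi>) \<in> mfd_atlas M. U) \<times> (\<Union>(V, \<psi>) \<in> mfd_atlas N. V)"
    unfolding atlas by (fastforce simp: prod_chart_eq)
  then have cover: "(\<Union>(W, \<Phi>) \<in> mfd_atlas (prod_manifold M N). W) =
      topspace (mfd_top (prod_manifold M N))"
    unfolding M(3) N(3) by (simp add: prod_manifold_def)
  show ?thesis
    unfolding rational_manifold_def
  proof (intro conjI ballI cover)
    show "Hausdorff_space (mfd_top (prod_manifold M N))"
      using assms by (simp add: rational_manifold_def prod_manifold_def Hausdorff_space_prod_topology)
    show "finite (mfd_atlas (prod_manifold M N))"
      using assms by (simp add: atlas rational_manifold_def)
  next
    fix c assume "c \<in> mfd_atlas (prod_manifold M N)"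
    then show "full_chart (mfd_dim (prod_manifold M N)) (mfd_top (prod_manifold M N)) c"
      using M(1) N(1) by (auto simp: prod_manifold_def intro!: full_chart_prod)
  next
    fix c c' assume "c \<in> mfd_atlas (prod_manifold M N)" "c' \<in> mfd_atlas (prod_manifold M N)"
    then show "rational_transition (mfd_dim (prod_manifold M N)) c c'"
      using M(1,2) N(1,2)
      by (auto simp: prod_manifold_def
          intro!: rational_transition_prod [of _ "mfd_top M" _ _ "mfd_top N"])
  qed
qed

text \<open>
  The slice charts are obtained in this way: the transition maps between the new chart and the
  charts of the atlas differ from old transition maps by \<open>\<Theta>\<close> or its inverse.
\<close>

lemma rational_reparametrization_in_maximal_atlas:
  fixes M :: "'a manifold"
  defines "d \<equiv> mfd_dim M"
  defines "E \<equiv> topspace (Euclidean_space d)"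
  assumes M: "rational_manifold M" and U: "(U, \<phi>) \<in> mfd_atlas M"
    and \<Theta>: "rational_map d E d \<Theta>" "rational_map d E d \<Theta>'"
    and inv: "\<And>x. x \<in> E \<Longrightarrow> \<Theta>' (\<Theta> x) = x" "\<And>x. x \<in> E \<Longrightarrow> \<Theta> (\<Theta>' x) = x"
  shows "(U, \<Theta> \<circ> \<phi>) \<in> maximal_atlas M"
proof -
  have chart: "full_chart d (mfd_top M) (U, \<phi>)"
    using M U by (auto simp: rational_manifold_def d_def)
  then have \<phi>: "inj_on \<phi> U" "\<phi> ` U = E"
    using full_chart_inj_on full_chart_image unfolding E_def by blast+
  have "homeomorphic_maps (Euclidean_space d) (Euclidean_space d) \<Theta> \<Theta>'"
    using rational_map_imp_continuous_map [OF \<Theta>(1)] rational_map_imp_continuous_map [OF \<Theta>(2)] inv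
    by (simp add: homeomorphic_maps_def E_def)
  then have "homeomorphic_map (Euclidean_space d) (Euclidean_space d) \<Theta>"
    using homeomorphic_map_maps by blast
  then have full: "full_chart d (mfd_top M) (U, \<Theta> \<circ> \<phi>)"
    using chart by (auto simp: full_chart_def intro: homeomorphic_map_compose)
  have "compatible_charts d (U, \<Theta> \<circ> \<phi>) (V, \<psi>)" if V: "(V, \<psi>) \<in> mfd_atlas M" for V \<psi>
  proof -
    have chart': "full_chart d (mfd_top M) (V, \<psi>)"
      and tr: "rational_map d (\<phi> ` (U \<inter> V)) d (\<psi> \<circ> inv_into U \<phi>)"
        "rational_map d (\<psi> ` (V \<inter> U)) d (\<phi> \<circ> inv_into V \<psi>)"
      using M U V by (fastforce simp: rational_manifold_def rational_transition_def d_def)+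
    have \<psi>: "\<psi> ` V = E"
      using full_chart_image [OF chart'] by (simp add: E_def)
    let ?W = "(\<Theta> \<circ> \<phi>) ` (U \<inter> V)"
    have W: "?W \<subseteq> E"
      using \<Theta>(1) \<phi>(2) by (auto simp: rational_map_def E_def)
    have "rational_map d ?W d ((\<psi> \<circ> inv_into U \<phi>) \<circ> \<Theta>')"
    proof (rule rational_map_compose [OF tr(1)])
      show "rational_map d ?W d \<Theta>'"
        using \<Theta>(2) W by (rule rational_map_mono) (use W E_def in simp)
      show "\<Theta>' ` ?W \<subseteq> \<phi> ` (U \<inter> V)"
        using inv \<phi>(2) by auto
    qed
    moreover have "((\<psi> \<circ> inv_into U \<phi>) \<circ> \<Theta>') z = (\<psi> \<circ> inv_into U (\<Theta> \<circ> \<phi>)) z" if "z \<in> ?W" for z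
    proof -
      obtain x where x: "x \<in> U" "z = (\<Theta> \<circ> \<phi>) x"
        using \<open>z \<in> ?W\<close> by blast
      have "inv_into U (\<Theta> \<circ> \<phi>) z = x"
        unfolding x(2) by (rule inv_into_f_f [OF full_chart_inj_on [OF full] x(1)])
      moreover have "\<Theta>' z = \<phi> x"
        using x \<phi>(2) inv by auto
      ultimately show ?thesis
        using \<phi>(1) x(1) by simp
    qed
    ultimately have "rational_map d ?W d (\<psi> \<circ> inv_into U (\<Theta> \<circ> \<phi>))"
      by (rule rational_map_cong)
    moreover have "rational_map d (\<psi> ` (V \<inter> U)) d (\<Theta> \<circ> (\<phi> \<circ> inv_into V \<psi>))"
      by (rule rational_map_compose [OF \<Theta>(1) tr(2)]) (use tr(2) in \<open>simp add: rational_map_def E_def\<close>)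
    ultimately show ?thesis
      using rational_imp_smooth_transition [OF full chart']
        rational_imp_smooth_transition [OF chart' full]
      by (simp add: compatible_charts_def rational_transition_def comp_assoc)
  qed
  with full_chart_imp_chart_on [OF full] show ?thesis
    by (auto simp: maximal_atlas_def d_def)
qed


section \<open>Rational matrix functions\<close>

definition mat_of_coords :: "nat \<Rightarrow> nat \<Rightarrow> (nat \<Rightarrow> real) \<Rightarrow> real mat" where
  "mat_of_coords n m x = mat n m (\<lambda>(i, j). x (i * m + j))"

lemma index_less_mult:
  fixes i j n m :: nat
  assumes "i < n" "j < m"
  shows "i * m + j < n * m"
proof -
  have "i * m + j < Suc i * m"
    using assms by simp
  also have "\<dots> \<le> n * m"
    using assms by (intro mult_right_mono) auto
  finally show ?thesis .
qed

lemma div_mod_less: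
  fixes i n m :: nat
  assumes "i < n * m"
  shows "i div m < n" "i mod m < m"
  using assms by (auto simp: less_mult_imp_div_less intro!: mod_less_divisor gr0I)

lemma mat_of_coords_carrier [simp]: "mat_of_coords n m x \<in> carrier_mat n m"
  by (simp add: mat_of_coords_def)

lemma mat_coords_in_Euclidean_space [simp]: "mat_coords n m A \<in> topspace (Euclidean_space (n * m))"
  by (auto simp: mat_coords_def topspace_Euclidean_space)

lemma mat_of_coords_mat_coords [simp]:
  assumes "A \<in> carrier_mat n m"
  shows "mat_of_coords n m (mat_coords n m A) = A"
  using assms index_less_mult by (intro eq_matI) (auto simp: mat_of_coords_def mat_coords_def)

lemma mat_coords_mat_of_coords [simp]:
  assumes "x \<in> topspace (Euclidean_space (n * m))"
  shows "mat_coords n m (mat_of_coords n m x) = x"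
proof
  fix i
  show "mat_coords n m (mat_of_coords n m x) i = x i"
  proof (cases "i < n * m")
    case True
    then show ?thesis
      using div_mod_less [OF True] by (simp add: mat_coords_def mat_of_coords_def)
  next
    case False
    then show ?thesis
      using assms by (simp add: mat_coords_def topspace_Euclidean_space)
  qed
qed

definition rational_mat ::
  "nat \<Rightarrow> (nat \<Rightarrow> real) set \<Rightarrow> nat \<Rightarrow> nat \<Rightarrow> ((nat \<Rightarrow> real) \<Rightarrow> real mat) \<Rightarrow> bool" where
  "rational_mat d W n m F \<longleftrightarrow>
     (\<forall>x\<in>W. F x \<in> carrier_mat n m) \<and> (\<forall>i<n. \<forall>j<m. rational_on d W (\<lambda>x. F x $$ (i, j)))"

lemma rational_mat_carrier: "rational_mat d W n m F \<Longrightarrow> x \<in> W \<Longrightarrow> F x \<in> carrier_mat n m"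
  by (simp add: rational_mat_def)

lemma rational_mat_entry:
  "rational_mat d W n m F \<Longrightarrow> i < n \<Longrightarrow> j < m \<Longrightarrow> rational_on d W (\<lambda>x. F x $$ (i, j))"
  by (simp add: rational_mat_def)

lemma rational_matI:
  assumes "\<And>x. x \<in> W \<Longrightarrow> F x \<in> carrier_mat n m"
    and "\<And>i j. i < n \<Longrightarrow> j < m \<Longrightarrow> rational_on d W (\<lambda>x. f x i j)"
    and "\<And>x i j. x \<in> W \<Longrightarrow> i < n \<Longrightarrow> j < m \<Longrightarrow> F x $$ (i, j) = f x i j"
  shows "rational_mat d W n m F"
  unfolding rational_mat_def
proof (intro conjI ballI allI impI)
  fix i j assume "i < n" "j < m"
  then show "rational_on d W (\<lambda>x. F x $$ (i, j))"
    using rational_on.cong [OF assms(2), of i j "\<lambda>x. F x $$ (i, j)"] assms(3) by simp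
qed (fact assms(1))

lemma rational_mat_mat_of_coords:
  assumes "rational_map d W (n * m) F"
  shows "rational_mat d W n m (\<lambda>x. mat_of_coords n m (F x))"
  by (rule rational_matI [where f = "\<lambda>x i j. F x (i * m + j)"])
     (use assms in \<open>simp_all add: rational_map_def mat_of_coords_def index_less_mult\<close>)

lemma rational_map_mat_coords:
  assumes "rational_mat d W n m F"
  shows "rational_map d W (n * m) (\<lambda>x. mat_coords n m (F x))"
proof -
  have "rational_on d W (\<lambda>x. mat_coords n m (F x) i)" if "i < n * m" for i
    using rational_mat_entry [OF assms div_mod_less [OF that]] that by (simp add: mat_coords_def)
  then show ?thesis
    by (auto simp: rational_map_def)
qed

lemma rational_mat_mult:
  assumes F: "rational_mat d W n m F" and G: "rational_mat d W m l G"
  shows "rational_mat d W n l (\<lambda>x. F x * G x)"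
proof (rule rational_matI)
  show "F x * G x \<in> carrier_mat n l" if "x \<in> W" for x
    using rational_mat_carrier [OF F that] rational_mat_carrier [OF G that] by simp
  show "rational_on d W (\<lambda>x. \<Sum>a\<in>{0..<m}. F x $$ (i, a) * G x $$ (a, j))" if "i < n" "j < l" for i j
    using rational_mat_entry [OF F] rational_mat_entry [OF G] that
    by (intro rational_on_sum rational_on.mult) auto
  show "(F x * G x) $$ (i, j) = (\<Sum>a\<in>{0..<m}. F x $$ (i, a) * G x $$ (a, j))"
    if "x \<in> W" "i < n" "j < l" for x i j
    using rational_mat_carrier [OF F that(1)] rational_mat_carrier [OF G that(1)] that
    by (auto simp: scalar_prod_def)
qed

lemma rational_mat_add:
  assumes F: "rational_mat d W n m F" and G: "rational_mat d W n m G"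
  shows "rational_mat d W n m (\<lambda>x. F x + G x)"
proof (rule rational_matI)
  show "rational_on d W (\<lambda>x. F x $$ (i, j) + G x $$ (i, j))" if "i < n" "j < m" for i j
    using rational_mat_entry [OF F that] rational_mat_entry [OF G that] by (rule rational_on.add)
next
  fix x assume "x \<in> W"
  then have *: "F x \<in> carrier_mat n m" "G x \<in> carrier_mat n m"
    using F G rational_mat_carrier by blast+
  then show "F x + G x \<in> carrier_mat n m"
    by simp
  show "(F x + G x) $$ (i, j) = F x $$ (i, j) + G x $$ (i, j)" if "i < n" "j < m" for i j
    using * that by simp
qed

lemma rational_mat_diff:
  assumes F: "rational_mat d W n m F" and G: "rational_mat d W n m G"
  shows "rational_mat d W n m (\<lambda>x. F x - G x)"
proof (rule rational_matI)
  show "rational_on d W (\<lambda>x. F x $$ (i, j) - G x $$ (i, j))" if "i < n" "j < m" for i j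
    using rational_mat_entry [OF F that] rational_mat_entry [OF G that] by (rule rational_on_diff)
next
  fix x assume "x \<in> W"
  then have *: "F x \<in> carrier_mat n m" "G x \<in> carrier_mat n m"
    using F G rational_mat_carrier by blast+
  then show "F x - G x \<in> carrier_mat n m"
    by auto
  show "(F x - G x) $$ (i, j) = F x $$ (i, j) - G x $$ (i, j)" if "i < n" "j < m" for i j
    using * that by simp
qed

text \<open>
  By the Leibniz formula the determinant is a polynomial in the entries.
\<close>

lemma rational_on_det:
  assumes F: "rational_mat d W n n F"
  shows "rational_on d W (\<lambda>x. det (F x))"
proof -
  have "rational_on d W (\<lambda>x. \<Sum>p | p permutes {0..<n}. signof p * (\<Prod>i = 0..<n. F x $$ (i, p i)))"
    by (intro rational_on_sum rational_on.mult rational_on.const rational_on_prod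
        rational_mat_entry [OF F]) (auto simp: permutes_in_image)
  then show ?thesis
    by (rule rational_on.cong) (simp add: det_def' [OF rational_mat_carrier [OF F]])
qed

lemma rational_mat_submatrix:
  assumes F: "rational_mat d W n m F"
  shows "rational_mat d W (card {i. i < n \<and> i \<in> I}) (card {j. j < m \<and> j \<in> J})
           (\<lambda>x. submatrix (F x) I J)"
proof (rule rational_matI)
  show "submatrix (F x) I J \<in> carrier_mat (card {i. i < n \<and> i \<in> I}) (card {j. j < m \<and> j \<in> J})"
    if "x \<in> W" for x
    using rational_mat_carrier [OF F that] by (auto simp: dim_submatrix)
  show "rational_on d W (\<lambda>x. F x $$ (pick I i, pick J j))"
    if "i < card {i. i < n \<and> i \<in> I}" "j < card {j. j < m \<and> j \<in> J}" for i j
    using that by (intro rational_mat_entry [OF F] pick_le)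
  show "submatrix (F x) I J $$ (i, j) = F x $$ (pick I i, pick J j)"
    if "x \<in> W" "i < card {i. i < n \<and> i \<in> I}" "j < card {j. j < m \<and> j \<in> J}" for x i j
    using rational_mat_carrier [OF F that(1)] that by (auto simp: submatrix_index)
qed

text \<open>
  The inverse by Cramer's rule, which is visibly rational in the entries.
\<close>

definition inverse_mat :: "real mat \<Rightarrow> real mat" where
  "inverse_mat A = inverse (det A) \<cdot>\<^sub>m adj_mat A"

lemma inverse_mat:
  assumes A: "A \<in> carrier_mat n n" and "det A \<noteq> 0"
  shows "inverse_mat A \<in> carrier_mat n n" "A * inverse_mat A = 1\<^sub>m n" "inverse_mat A * A = 1\<^sub>m n"
proof -
  have *: "inverse (det A) \<cdot>\<^sub>m (det A \<cdot>\<^sub>m 1\<^sub>m n) = 1\<^sub>m n"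
    using \<open>det A \<noteq> 0\<close> by (intro eq_matI) auto
  show "inverse_mat A \<in> carrier_mat n n"
    using adj_mat(1) [OF A] by (simp add: inverse_mat_def)
  show "A * inverse_mat A = 1\<^sub>m n"
    using mult_smult_distrib [OF A adj_mat(1) [OF A], of "inverse (det A)"] *
    by (simp add: inverse_mat_def adj_mat(2) [OF A])
  show "inverse_mat A * A = 1\<^sub>m n"
    using mult_smult_assoc_mat [OF adj_mat(1) [OF A] A, of "inverse (det A)"] *
    by (simp add: inverse_mat_def adj_mat(3) [OF A])
qed

lemma invertible_mat_iff_det_nonzero:
  fixes A :: "real mat"
  assumes A: "A \<in> carrier_mat n n"
  shows "invertible_mat A \<longleftrightarrow> det A \<noteq> 0"
proof
  assume "invertible_mat A"
  then obtain B where B: "A * B = 1\<^sub>m n" "B * A = 1\<^sub>m (dim_row B)"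
    using A by (auto simp: invertible_mat_def inverts_mat_def)
  have "B \<in> carrier_mat n n"
    using arg_cong [OF B(1), of dim_col] arg_cong [OF B(2), of dim_col] A by auto
  then have "det A * det B = 1"
    using B(1) det_mult [OF A] by (metis det_one)
  then show "det A \<noteq> 0"
    by auto
next
  assume "det A \<noteq> 0"
  from inverse_mat [OF A this] show "invertible_mat A"
    using A unfolding invertible_mat_def inverts_mat_def
    by (intro conjI exI [of _ "inverse_mat A"]) auto
qed

lemma inverse_mat_one [simp]: "inverse_mat (1\<^sub>m n) = 1\<^sub>m n"
  using inverse_mat [of "1\<^sub>m n" n] by (simp add: left_mult_one_mat)

lemma rational_mat_inverse_mat:
  assumes F: "rational_mat d W n n F" and "\<And>x. x \<in> W \<Longrightarrow> det (F x) \<noteq> 0"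
  shows "rational_mat d W n n (\<lambda>x. inverse_mat (F x))"
proof (rule rational_matI [where
      f = "\<lambda>x i j. inverse (det (F x)) * ((- 1) ^ (j + i) * det (mat_delete (F x) j i))"])
  have "rational_mat d W (n - 1) (n - 1) (\<lambda>x. mat_delete (F x) i j)" if "i < n" "j < n" for i j
  proof (rule rational_matI [where
        f = "\<lambda>x a b. F x $$ (if a < i then a else Suc a, if b < j then b else Suc b)"])
    show "rational_on d W (\<lambda>x. F x $$ (if a < i then a else Suc a, if b < j then b else Suc b))"
      if "a < n - 1" "b < n - 1" for a b
      using that by (intro rational_mat_entry [OF F]) auto
  next
    fix x assume "x \<in> W"
    then have *: "F x \<in> carrier_mat n n"
      by (rule rational_mat_carrier [OF F])
    then show "mat_delete (F x) i j \<in> carrier_mat (n - 1) (n - 1)"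
      by (rule mat_delete_carrier)
    show "mat_delete (F x) i j $$ (a, b) =
        F x $$ (if a < i then a else Suc a, if b < j then b else Suc b)"
      if "a < n - 1" "b < n - 1" for a b
      using * that by (simp add: mat_delete_def)
  qed
  then show "rational_on d W (\<lambda>x. inverse (det (F x)) * ((- 1) ^ (j + i) * det (mat_delete (F x) j i)))"
    if "i < n" "j < n" for i j
    using that assms(2)
    by (intro rational_on.mult rational_on.inverse rational_on.const rational_on_det [OF F]
        rational_on_det ballI)
next
  fix x assume "x \<in> W"
  then have *: "F x \<in> carrier_mat n n"
    by (rule rational_mat_carrier [OF F])
  show "inverse_mat (F x) \<in> carrier_mat n n"
    using inverse_mat(1) [OF * assms(2) [OF \<open>x \<in> W\<close>]] .
  show "inverse_mat (F x) $$ (i, j) = inverse (det (F x)) * ((- 1) ^ (j + i) * det (mat_delete (F x) j i))"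
      if "i < n" "j < n" for i j
    using * that by (auto simp: inverse_mat_def adj_mat_def cofactor_def)
qed


section \<open>The space of matrices as a manifold\<close>

lemma continuous_map_mat_coords:
  "continuous_map (mat_topology n m) (Euclidean_space (n * m)) (mat_coords n m)"
  using continuous_map_pullback [OF continuous_map_id, of "carrier_mat n m" "mat_coords n m" "Euclidean_space (n * m)"]
  by (simp add: mat_topology_def)

lemma continuous_map_into_mat_topology:
  assumes "rational_mat d (topspace (Euclidean_space d)) n m F"
  shows "continuous_map (Euclidean_space d) (mat_topology n m) F"
  unfolding mat_topology_def
proof (rule continuous_map_pullback')
  show "continuous_map (Euclidean_space d) (Euclidean_space (n * m)) (mat_coords n m \<circ> F)"
    using rational_map_imp_continuous_map [OF rational_map_mat_coords [OF assms]]
    by (simp add: comp_def)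
  show "topspace (Euclidean_space d) \<subseteq> F -` carrier_mat n m"
    using rational_mat_carrier [OF assms] by auto
qed

text \<open>
  The topology on matrices is pulled back along the coordinates, so continuity can be read off from
  the expression of a function in coordinates.
\<close>

lemma rational_imp_continuous_map_mat:
  assumes "rational_on (n * m) (mat_coords n m ` S) (\<lambda>x. f (mat_of_coords n m x))"
    and "S \<subseteq> carrier_mat n m"
  shows "continuous_map (subtopology (mat_topology n m) S) euclideanreal f"
proof -
  have "continuous_map (subtopology (mat_topology n m) S)
      (subtopology (Euclidean_space (n * m)) (mat_coords n m ` S)) (mat_coords n m)"
    by (auto simp: continuous_map_in_subtopology
        intro: continuous_map_from_subtopology continuous_map_mat_coords)
  from continuous_map_compose [OF this rational_on_imp_continuous_map [OF assms(1)]]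
  show ?thesis
    by (rule continuous_map_eq) (use assms(2) in auto)
qed

lemma rational_imp_continuous_map_mat_Euclidean:
  assumes "rational_map (n * m) (mat_coords n m ` S) e (\<lambda>x. f (mat_of_coords n m x))"
    and "S \<subseteq> carrier_mat n m"
  shows "continuous_map (subtopology (mat_topology n m) S) (Euclidean_space e) f"
proof -
  have "continuous_map (subtopology (mat_topology n m) S)
      (subtopology (Euclidean_space (n * m)) (mat_coords n m ` S)) (mat_coords n m)"
    by (auto simp: continuous_map_in_subtopology
        intro: continuous_map_from_subtopology continuous_map_mat_coords)
  moreover have "mat_coords n m ` S \<subseteq> topspace (Euclidean_space (n * m))"
    by auto
  ultimately have "continuous_map (subtopology (mat_topology n m) S) (Euclidean_space e)
      ((\<lambda>x. f (mat_of_coords n m x)) \<circ> mat_coords n m)"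
    using continuous_map_compose rational_map_imp_continuous_map [OF assms(1)] by blast
  then show ?thesis
    by (rule continuous_map_eq) (use assms(2) in auto)
qed

lemma rational_mat_mat_of_coords_image:
  "rational_mat (n * m) (mat_coords n m ` S) n m (mat_of_coords n m)"
  by (rule rational_mat_mat_of_coords [OF rational_map_id]) auto

lemma homeomorphic_maps_mat_coords:
  "homeomorphic_maps (mat_topology n m) (Euclidean_space (n * m)) (mat_coords n m) (mat_of_coords n m)"
  using continuous_map_mat_coords
    continuous_map_into_mat_topology [OF rational_mat_mat_of_coords [OF rational_map_id [OF subset_refl]]]
  by (auto simp: homeomorphic_maps_def topspace_mat_topology)

lemma Hausdorff_space_Euclidean_space: "Hausdorff_space (Euclidean_space d)"
  using metrizable_Euclidean_space metrizable_imp_Hausdorff_space by blast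

lemma rational_manifold_mat_manifold: "rational_manifold (mat_manifold n m)"
proof -
  have hom: "homeomorphic_map (mat_topology n m) (Euclidean_space (n * m)) (mat_coords n m)"
    using homeomorphic_maps_mat_coords homeomorphic_map_maps by blast
  have img: "mat_coords n m ` carrier_mat n m = topspace (Euclidean_space (n * m))"
    using homeomorphic_imp_surjective_map [OF hom] by (simp add: topspace_mat_topology)
  have "Hausdorff_space (mat_topology n m)"
    using homeomorphic_Hausdorff_space homeomorphic_map_imp_homeomorphic_space [OF hom]
      Hausdorff_space_Euclidean_space by blast
  moreover have "full_chart (n * m) (mat_topology n m) (carrier_mat n m, mat_coords n m)"
    using hom openin_topspace [of "mat_topology n m"] subtopology_topspace [of "mat_topology n m"]
    by (simp add: full_chart_def topspace_mat_topology)
  moreover have "rational_transition (n * m) (carrier_mat n m, mat_coords n m) (carrier_mat n m, mat_coords n m)"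
    unfolding rational_transition_def prod.case Int_absorb img
    by (rule rational_map_cong [OF rational_map_id]) (simp_all add: f_inv_into_f img)
  ultimately show ?thesis
    by (simp add: rational_manifold_def mat_manifold_def topspace_mat_topology)
qed


section \<open>Splitting matrices along a set of indices\<close>

text \<open>
  A set \<open>J\<close> of \<open>k\<close> among \<open>m\<close> indices divides the rows of an \<open>m \<times> l\<close> matrix, or the columns of an
  \<open>n \<times> m\<close> matrix, into two blocks.  The \<open>b\<close>-th index of a block is \<open>pick J b\<close> or \<open>pick (- J) b\<close>,
  and the position of \<open>i\<close> within its block is the number of smaller indices in the block.
\<close>

locale index_split =
  fixes m k :: nat and J :: "nat set"
  assumes J_subset: "J \<subseteq> {..<m}" and card_J: "card J = k"
begin

lemma k_le_m: "k \<le> m"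
  using card_mono [OF _ J_subset] card_J by simp

lemma finite_J: "finite J"
  using J_subset finite_subset by blast

lemma infinite_Compl_J: "infinite (- J)"
  using finite_J by simp

lemma card_rows_J [simp]: "card {i. i < m \<and> i \<in> J} = k"
proof -
  have "{i. i < m \<and> i \<in> J} = J"
    using J_subset by auto
  then show ?thesis
    using card_J by simp
qed

lemma card_rows_Compl_J [simp]: "card {i. i < m \<and> i \<notin> J} = m - k"
proof -
  have "{i. i < m \<and> i \<notin> J} = {..<m} - J"
    by auto
  then show ?thesis
    using card_Diff_subset [OF finite_J J_subset] card_J by simp
qed

lemma pick_J:
  assumes "b < k"
  shows "pick J b \<in> J" "pick J b < m" "card {a \<in> J. a < pick J b} = b"
proof -
  have b: "b < card J"
    using assms card_J by simp
  show "pick J b \<in> J" "card {a \<in> J. a < pick J b} = b"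
    by (rule pick_in_set_le [OF b], rule card_pick_le [OF b])
  then show "pick J b < m"
    using J_subset by auto
qed

lemma pick_Compl_J:
  assumes "b < m - k"
  shows "pick (- J) b \<notin> J" "pick (- J) b < m" "card {a. a \<notin> J \<and> a < pick (- J) b} = b"
  using assms pick_in_set_inf [OF infinite_Compl_J, of b] card_pick_inf [OF infinite_Compl_J, of b]
    pick_le [of b m "- J"] by auto

lemma position_J:
  assumes "i \<in> J"
  shows "card {a \<in> J. a < i} < k" "pick J (card {a \<in> J. a < i}) = i"
proof -
  have "{a \<in> J. a < i} \<subset> J"
    using assms by auto
  then show "card {a \<in> J. a < i} < k"
    using psubset_card_mono [OF finite_J] card_J by metis
  show "pick J (card {a \<in> J. a < i}) = i"
    by (rule pick_card_in_set [OF assms])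
qed

lemma position_Compl_J:
  assumes "i < m" "i \<notin> J"
  shows "card {a. a \<notin> J \<and> a < i} < m - k" "pick (- J) (card {a. a \<notin> J \<and> a < i}) = i"
proof -
  have "{a. a \<notin> J \<and> a < i} \<subset> {a. a < m \<and> a \<notin> J}"
    using assms by auto
  then have "card {a. a \<notin> J \<and> a < i} < card {a. a < m \<and> a \<notin> J}"
    by (intro psubset_card_mono) auto
  then show "card {a. a \<notin> J \<and> a < i} < m - k"
    by simp
  show "pick (- J) (card {a. a \<notin> J \<and> a < i}) = i"
    using pick_card_in_set [of i "- J"] assms by simp
qed

lemma sum_split:
  fixes f :: "nat \<Rightarrow> real"
  shows "(\<Sum>i<m. f i) = (\<Sum>b<k. f (pick J b)) + (\<Sum>a<m - k. f (pick (- J) a))"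
proof -
  have "bij_betw (pick J) {..<k} J"
    by (rule bij_betw_byWitness [where f' = "\<lambda>i. card {a \<in> J. a < i}"])
       (use pick_J position_J in auto)
  moreover have "bij_betw (pick (- J)) {..<m - k} ({..<m} - J)"
    by (rule bij_betw_byWitness [where f' = "\<lambda>i. card {a. a \<notin> J \<and> a < i}"])
       (use pick_Compl_J position_Compl_J in auto)
  ultimately have "(\<Sum>b<k. f (pick J b)) = sum f J" "(\<Sum>a<m - k. f (pick (- J) a)) = sum f ({..<m} - J)"
    by (auto intro: sum.reindex_bij_betw)
  then show ?thesis
    using sum.subset_diff [OF J_subset, of f] by simp
qed

abbreviation rows_J :: "real mat \<Rightarrow> real mat" where "rows_J Y \<equiv> submatrix Y J UNIV"
abbreviation rows_compl :: "real mat \<Rightarrow> real mat" where "rows_compl Y \<equiv> submatrix Y (- J) UNIV"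
abbreviation cols_J :: "real mat \<Rightarrow> real mat" where "cols_J A \<equiv> submatrix A UNIV J"
abbreviation cols_compl :: "real mat \<Rightarrow> real mat" where "cols_compl A \<equiv> submatrix A UNIV (- J)"

lemma rows_carrier:
  assumes "Y \<in> carrier_mat m l"
  shows "rows_J Y \<in> carrier_mat k l" "rows_compl Y \<in> carrier_mat (m - k) l"
  using assms by (auto simp: dim_submatrix)

lemma cols_carrier:
  assumes "A \<in> carrier_mat n m"
  shows "cols_J A \<in> carrier_mat n k" "cols_compl A \<in> carrier_mat n (m - k)"
  using assms by (auto simp: dim_submatrix)

lemma rows_index:
  assumes "Y \<in> carrier_mat m l" "j < l"
  shows "i < k \<Longrightarrow> rows_J Y $$ (i, j) = Y $$ (pick J i, j)"
    "i < m - k \<Longrightarrow> rows_compl Y $$ (i, j) = Y $$ (pick (- J) i, j)"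
  using assms by (auto simp: submatrix_index pick_UNIV)

lemma cols_index:
  assumes "A \<in> carrier_mat n m" "i < n"
  shows "j < k \<Longrightarrow> cols_J A $$ (i, j) = A $$ (i, pick J j)"
    "j < m - k \<Longrightarrow> cols_compl A $$ (i, j) = A $$ (i, pick (- J) j)"
  using assms by (auto simp: submatrix_index pick_UNIV)

text \<open>
  The matrices with prescribed blocks, inverse to taking the two blocks.
\<close>

definition stack_rows :: "nat \<Rightarrow> real mat \<Rightarrow> real mat \<Rightarrow> real mat" where
  "stack_rows l P Q = mat m l (\<lambda>(i, j). if i \<in> J then P $$ (card {a \<in> J. a < i}, j)
                                     else Q $$ (card {a. a \<notin> J \<and> a < i}, j))"

definition stack_cols :: "nat \<Rightarrow> real mat \<Rightarrow> real mat \<Rightarrow> real mat" where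
  "stack_cols n P Q = mat n m (\<lambda>(i, j). if j \<in> J then P $$ (i, card {a \<in> J. a < j})
                                     else Q $$ (i, card {a. a \<notin> J \<and> a < j}))"

lemma stack_carrier [simp]:
  "stack_rows l P Q \<in> carrier_mat m l" "stack_cols n P Q \<in> carrier_mat n m"
  by (simp_all add: stack_rows_def stack_cols_def)

lemma rows_stack_rows:
  assumes "P \<in> carrier_mat k l" "Q \<in> carrier_mat (m - k) l"
  shows "rows_J (stack_rows l P Q) = P" "rows_compl (stack_rows l P Q) = Q"
proof -
  have *: "stack_rows l P Q \<in> carrier_mat m l"
    by simp
  show "rows_J (stack_rows l P Q) = P"
    using assms rows_carrier [OF *] pick_J
    by (intro eq_matI) (auto simp: rows_index [OF *], auto simp: stack_rows_def)
  show "rows_compl (stack_rows l P Q) = Q"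
    using assms rows_carrier [OF *] pick_Compl_J
    by (intro eq_matI) (auto simp: rows_index [OF *], auto simp: stack_rows_def)
qed

lemma cols_stack_cols:
  assumes "P \<in> carrier_mat n k" "Q \<in> carrier_mat n (m - k)"
  shows "cols_J (stack_cols n P Q) = P" "cols_compl (stack_cols n P Q) = Q"
proof -
  have *: "stack_cols n P Q \<in> carrier_mat n m"
    by simp
  show "cols_J (stack_cols n P Q) = P"
    using assms cols_carrier [OF *] pick_J
    by (intro eq_matI) (auto simp: cols_index [OF *], auto simp: stack_cols_def)
  show "cols_compl (stack_cols n P Q) = Q"
    using assms cols_carrier [OF *] pick_Compl_J
    by (intro eq_matI) (auto simp: cols_index [OF *], auto simp: stack_cols_def)
qed

lemma stack_rows_rows:
  assumes "Y \<in> carrier_mat m l"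
  shows "stack_rows l (rows_J Y) (rows_compl Y) = Y"
  using assms position_J position_Compl_J
  by (intro eq_matI) (auto simp: stack_rows_def rows_index [OF assms])

lemma stack_cols_cols:
  assumes "A \<in> carrier_mat n m"
  shows "stack_cols n (cols_J A) (cols_compl A) = A"
  using assms position_J position_Compl_J
  by (intro eq_matI) (auto simp: stack_cols_def cols_index [OF assms])

lemma rows_mult:
  assumes Y: "Y \<in> carrier_mat m l" and G: "G \<in> carrier_mat l l'"
  shows "rows_J (Y * G) = rows_J Y * G" "rows_compl (Y * G) = rows_compl Y * G"
proof -
  have YG: "Y * G \<in> carrier_mat m l'"
    using Y G by simp
  show "rows_J (Y * G) = rows_J Y * G"
    using rows_carrier [OF YG] rows_carrier [OF Y] Y G pick_J
    by (intro eq_matI) (auto simp: rows_index [OF YG] rows_index [OF Y] scalar_prod_def)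
  show "rows_compl (Y * G) = rows_compl Y * G"
    using rows_carrier [OF YG] rows_carrier [OF Y] Y G pick_Compl_J
    by (intro eq_matI) (auto simp: rows_index [OF YG] rows_index [OF Y] scalar_prod_def)
qed

lemma stack_rows_mult:
  assumes P: "P \<in> carrier_mat k l" and Q: "Q \<in> carrier_mat (m - k) l" and G: "G \<in> carrier_mat l l'"
  shows "stack_rows l P Q * G = stack_rows l' (P * G) (Q * G)"
  using stack_rows_rows [OF mult_carrier_mat [OF stack_carrier(1) G], of P Q]
  by (simp add: rows_mult [OF stack_carrier(1) G] rows_stack_rows [OF P Q])

text \<open>
  Block multiplication.  With \<open>P = 1\<close> it turns the equation \<open>A Y = 0\<close> into one that can be solved
  for the columns of \<open>A\<close> in \<open>J\<close>.
\<close>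

lemma mult_stack_rows:
  assumes A: "A \<in> carrier_mat n m" and P: "P \<in> carrier_mat k l" and Q: "Q \<in> carrier_mat (m - k) l"
  shows "A * stack_rows l P Q = cols_J A * P + cols_compl A * Q"
proof (rule eq_matI)
  fix i j assume "i < dim_row (cols_J A * P + cols_compl A * Q)"
    "j < dim_col (cols_J A * P + cols_compl A * Q)"
  then have ij: "i < n" "j < l"
    using cols_carrier [OF A] P Q by auto
  let ?S = "stack_rows l P Q"
  have S: "?S $$ (pick J b, j) = P $$ (b, j)" if "b < k" for b
    using rows_index(1) [of ?S l j b] rows_stack_rows(1) [OF P Q] that ij by simp
  have S': "?S $$ (pick (- J) b, j) = Q $$ (b, j)" if "b < m - k" for b
    using rows_index(2) [of ?S l j b] rows_stack_rows(2) [OF P Q] that ij by simp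
  have "(A * ?S) $$ (i, j) = (\<Sum>a<m. A $$ (i, a) * ?S $$ (a, j))"
    using A ij by (simp add: stack_rows_def scalar_prod_def atLeast0LessThan)
  also have "\<dots> = (\<Sum>b<k. cols_J A $$ (i, b) * P $$ (b, j)) +
      (\<Sum>a<m - k. cols_compl A $$ (i, a) * Q $$ (a, j))"
    unfolding sum_split using S S' cols_index [OF A ij(1)] by simp
  also have "\<dots> = (cols_J A * P + cols_compl A * Q) $$ (i, j)"
    using A P Q ij cols_carrier [OF A] by (simp add: scalar_prod_def atLeast0LessThan)
  finally show "(A * ?S) $$ (i, j) = (cols_J A * P + cols_compl A * Q) $$ (i, j)" .
qed (use cols_carrier [OF A] A P Q in \<open>auto simp: stack_rows_def\<close>)

lemma rational_mat_stack_rows: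
  assumes P: "rational_mat d W k l P" and Q: "rational_mat d W (m - k) l Q"
  shows "rational_mat d W m l (\<lambda>x. stack_rows l (P x) (Q x))"
proof (rule rational_matI [where
      f = "\<lambda>x i j. if i \<in> J then P x $$ (card {a \<in> J. a < i}, j)
                   else Q x $$ (card {a. a \<notin> J \<and> a < i}, j)"])
  fix i j assume "i < m" "j < l"
  then show "rational_on d W (\<lambda>x. if i \<in> J then P x $$ (card {a \<in> J. a < i}, j)
                   else Q x $$ (card {a. a \<notin> J \<and> a < i}, j))"
    using rational_mat_entry [OF P] rational_mat_entry [OF Q] position_J position_Compl_J
    by (cases "i \<in> J") simp_all
qed (simp_all add: stack_rows_def)

lemma rational_mat_stack_cols:
  assumes P: "rational_mat d W n k P" and Q: "rational_mat d W n (m - k) Q"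
  shows "rational_mat d W n m (\<lambda>x. stack_cols n (P x) (Q x))"
proof (rule rational_matI [where
      f = "\<lambda>x i j. if j \<in> J then P x $$ (i, card {a \<in> J. a < j})
                   else Q x $$ (i, card {a. a \<notin> J \<and> a < j})"])
  fix i j assume "i < n" "j < m"
  then show "rational_on d W (\<lambda>x. if j \<in> J then P x $$ (i, card {a \<in> J. a < j})
                   else Q x $$ (i, card {a. a \<notin> J \<and> a < j}))"
    using rational_mat_entry [OF P] rational_mat_entry [OF Q] position_J position_Compl_J
    by (cases "j \<in> J") simp_all
qed (simp_all add: stack_cols_def)

lemma rational_mat_rows:
  assumes "rational_mat d W m l F"
  shows "rational_mat d W k l (\<lambda>x. rows_J (F x))" "rational_mat d W (m - k) l (\<lambda>x. rows_compl (F x))"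
  using rational_mat_submatrix [OF assms, of J UNIV] rational_mat_submatrix [OF assms, of "- J" UNIV]
  by simp_all

lemma rational_mat_cols:
  assumes "rational_mat d W n m F"
  shows "rational_mat d W n k (\<lambda>x. cols_J (F x))" "rational_mat d W n (m - k) (\<lambda>x. cols_compl (F x))"
  using rational_mat_submatrix [OF assms, of UNIV J] rational_mat_submatrix [OF assms, of UNIV "- J"]
  by simp_all

end


section \<open>Full rank and maximal minors\<close>

text \<open>
  If two columns were equal, the set of columns would have fewer than \<open>k\<close> elements and could not span
  a space of dimension \<open>k\<close>.  So the columns are distinct and linearly independent.
\<close>

lemma stiefel_imp_injective:
  assumes Y: "Y \<in> stiefel m k" and v: "v \<in> carrier_vec k" "Y *\<^sub>v v = 0\<^sub>v m"
  shows "v = 0\<^sub>v k"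
proof -
  interpret vec_space "TYPE(real)" m .
  have Yc: "Y \<in> carrier_mat m k" "rank Y = k"
    using Y by (auto simp: stiefel_def)
  obtain S where S: "maximal S (\<lambda>T. T \<subseteq> set (cols Y) \<and> lin_indpt T)"
    using maximal_exists [of "(\<lambda>T. T \<subseteq> set (cols Y) \<and> lin_indpt T)" "card (set (cols Y))" "{}"]
    by (meson List.finite_set card_mono empty_iff empty_subsetI finite_lin_indpt2 rev_finite_subset)
  then have "k \<le> card (set (cols Y))"
    using rank_card_indpt [OF Yc(1) S] Yc(2) by (simp add: card_mono maximal_def)
  then have "distinct (cols Y)"
    using Yc(1) card_length [of "cols Y"] by (intro card_distinct) auto
  then show ?thesis
    using full_rank_lin_indpt [OF Yc] lin_depI [OF Yc(1) v(1) _ v(2)] by blast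
qed

text \<open>
  If \<open>Y\<^sup>T Y v = 0\<close>, then \<open>Y v\<close> has square norm \<open>v \<bullet> Y\<^sup>T Y v = 0\<close>, hence \<open>Y v = 0\<close> and \<open>v = 0\<close>.
\<close>

lemma det_transpose_mult_nonzero:
  assumes Y: "Y \<in> stiefel m k"
  shows "det (Y\<^sup>T * Y) \<noteq> 0"
proof
  have Yc: "Y \<in> carrier_mat m k"
    using Y by (simp add: stiefel_def)
  assume "det (Y\<^sup>T * Y) = 0"
  then obtain v where v: "v \<in> carrier_vec k" "v \<noteq> 0\<^sub>v k" "(Y\<^sup>T * Y) *\<^sub>v v = 0\<^sub>v k"
    using det_0_iff_vec_prod_zero_field [of "Y\<^sup>T * Y" k] Yc by auto
  define w where "w = Y *\<^sub>v v"
  have w: "w \<in> carrier_vec m"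
    using Yc v by (simp add: w_def)
  have "Y\<^sup>T *\<^sub>v w = 0\<^sub>v k"
    using v Yc by (simp add: w_def assoc_mult_mat_vec [of _ k m])
  then have "scalar_prod w w = 0"
    using transpose_vec_mult_scalar [OF Yc v(1) w] v(1) by (simp flip: w_def)
  then have "(\<Sum>i = 0..<m. vec_index w i * vec_index w i) = 0"
    using w by (simp add: scalar_prod_def)
  then have "\<forall>i\<in>{0..<m}. vec_index w i * vec_index w i = 0"
    by (subst (asm) sum_nonneg_eq_0_iff) auto
  then have "w = 0\<^sub>v m"
    using w by (intro eq_vecI) auto
  then show False
    using stiefel_imp_injective [OF Y v(1)] v(2) by (simp add: w_def)
qed

text \<open>
  The rows of \<open>Y\<^sup>T Y\<close> are linear combinations of rows of \<open>Y\<close>.  Expanding \<open>det (Y\<^sup>T Y) \<noteq> 0\<close> in each row,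
  some choice \<open>f\<close> of \<open>k\<close> rows of \<open>Y\<close> has nonzero determinant.  Then \<open>f\<close> is injective, and
  \<open>J\<close> is its range.  Listing these rows in increasing order preserves
  nonsingularity, which is checked on kernels so that no sign of a permutation has to be computed.
\<close>

lemma stiefel_imp_minor_nonzero:
  assumes Y: "Y \<in> stiefel m k"
  obtains J where "J \<subseteq> {..<m}" "card J = k" "det (submatrix Y J UNIV) \<noteq> 0"
proof -
  have Yc: "Y \<in> carrier_mat m k"
    using Y by (simp add: stiefel_def)
  let ?U = "{0..<k}" and ?T = "{0..<m}"
  let ?F = "{f. (\<forall>i\<in>?U. f i \<in> ?T) \<and> (\<forall>i. i \<notin> ?U \<longrightarrow> f i = i)}"
  have "det (Y\<^sup>T * Y) = det (mat\<^sub>r k k (\<lambda>i. finsum_vec TYPE(real) k (\<lambda>a. Y\<^sup>T $$ (i, a) \<cdot>\<^sub>v row Y a) ?T))"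
    using mat_mul_finsum_alt [of "Y\<^sup>T" k m Y k] Yc by simp
  also have "\<dots> = (\<Sum>f\<in>?F. det (mat\<^sub>r k k (\<lambda>i. Y\<^sup>T $$ (i, f i) \<cdot>\<^sub>v row Y (f i))))"
    by (rule det_linear_rows_sum) (use Yc in auto)
  finally have "(\<Sum>f\<in>?F. det (mat\<^sub>r k k (\<lambda>i. Y\<^sup>T $$ (i, f i) \<cdot>\<^sub>v row Y (f i)))) \<noteq> 0"
    using det_transpose_mult_nonzero [OF Y] by simp
  then obtain f where f: "f \<in> ?F" "det (mat\<^sub>r k k (\<lambda>i. Y\<^sup>T $$ (i, f i) \<cdot>\<^sub>v row Y (f i))) \<noteq> 0"
    by (meson sum.neutral)
  let ?B = "mat\<^sub>r k k (\<lambda>i. row Y (f i))"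
  have B: "?B \<in> carrier_mat k k"
    by simp
  have detB: "det ?B \<noteq> 0"
    using f(2) det_rows_mul [of "\<lambda>i. row Y (f i)" k "\<lambda>i. Y\<^sup>T $$ (i, f i)"] Yc by auto
  have rowB: "row ?B i = row Y (f i)" if "i < k" for i
    using that Yc by simp
  have "inj_on f ?U"
  proof (rule inj_onI, rule ccontr)
    fix i j assume "i \<in> ?U" "j \<in> ?U" "f i = f j" "i \<noteq> j"
    then have "det ?B = 0"
      using rowB by (intro det_identical_rows [OF B, of i j]) auto
    with detB show False
      by simp
  qed
  then have J: "f ` ?U \<subseteq> {..<m}" "card (f ` ?U) = k"
    using f(1) card_image [of f ?U] by auto
  interpret index_split m k "f ` ?U"
    using J by unfold_locales
  have "det (submatrix Y (f ` ?U) UNIV) \<noteq> 0"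
  proof
    assume "det (submatrix Y (f ` ?U) UNIV) = 0"
    then obtain v where v: "v \<in> carrier_vec k" "v \<noteq> 0\<^sub>v k" "rows_J Y *\<^sub>v v = 0\<^sub>v k"
      using det_0_iff_vec_prod_zero_field [OF rows_carrier(1) [OF Yc]] by auto
    have "row Y (f i) \<bullet> v = 0" if "i < k" for i
    proof -
      obtain b where b: "b < k" "f i = pick (f ` ?U) b"
        using position_J [of "f i"] \<open>i < k\<close> by fastforce
      have "row (rows_J Y) b = row Y (f i)"
        using row_submatrix_UNIV [of b Y "f ` ?U"] b Yc card_rows_J by auto
      then show ?thesis
        using arg_cong [OF v(3), of "\<lambda>w. vec_index w b"] b rows_carrier(1) [OF Yc] by auto
    qed
    then have "?B *\<^sub>v v = 0\<^sub>v k"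
      using rowB by (intro eq_vecI) auto
    then show False
      using det_0_iff_vec_prod_zero_field [OF B] detB v(1,2) by blast
  qed
  with J that show ?thesis
    by blast
qed

lemma (in index_split) minor_nonzero_imp_stiefel:
  assumes Y: "Y \<in> carrier_mat m k" and "det (rows_J Y) \<noteq> 0"
  shows "Y \<in> stiefel m k"
proof -
  interpret vec_space "TYPE(real)" m .
  have "card {j. j < k \<and> j \<in> UNIV} \<le> rank Y"
    by (rule rank_gt_minor [OF Y assms(2)])
  then show ?thesis
    using rank_le_nc [OF Y] Y by (auto simp: stiefel_def)
qed


section \<open>The Grassmann manifold\<close>

lemma GL_mat_eq: "GL_mat k = {G \<in> carrier_mat k k. det G \<noteq> 0}"
  using invertible_mat_iff_det_nonzero by (auto simp: GL_mat_def)

lemma GL_orbit_self: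
  assumes "Y \<in> carrier_mat m k"
  shows "Y \<in> GL_orbit k Y"
proof -
  have "Y = Y * 1\<^sub>m k" "1\<^sub>m k \<in> GL_mat k"
    using assms by (auto simp: GL_mat_eq)
  then show ?thesis
    unfolding GL_orbit_def by blast
qed

lemma GL_orbit_mult_subset:
  assumes Y: "Y \<in> carrier_mat m k" and G: "G \<in> GL_mat k"
  shows "GL_orbit k (Y * G) \<subseteq> GL_orbit k Y"
proof
  fix Z assume "Z \<in> GL_orbit k (Y * G)"
  then obtain H where H: "H \<in> GL_mat k" "Z = Y * G * H"
    by (auto simp: GL_orbit_def)
  have "Z = Y * (G * H)" "G * H \<in> GL_mat k"
    using Y G H by (auto simp: GL_mat_eq det_mult)
  then show "Z \<in> GL_orbit k Y"
    unfolding GL_orbit_def by blast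
qed

lemma GL_orbit_mult:
  assumes Y: "Y \<in> carrier_mat m k" and G: "G \<in> GL_mat k"
  shows "GL_orbit k (Y * G) = GL_orbit k Y"
proof (rule subset_antisym)
  have Gc: "G \<in> carrier_mat k k" "det G \<noteq> 0"
    using G by (auto simp: GL_mat_eq)
  note inv = inverse_mat [OF Gc]
  have "det G * det (inverse_mat G) = 1"
    using det_mult [OF Gc(1) inv(1)] inv(2) by simp
  then have "inverse_mat G \<in> GL_mat k"
    using inv(1) by (auto simp: GL_mat_eq)
  moreover have "Y * G * inverse_mat G = Y"
    using Y Gc inv by (simp add: assoc_mult_mat [OF Y Gc(1) inv(1)])
  ultimately show "GL_orbit k Y \<subseteq> GL_orbit k (Y * G)"
    using GL_orbit_mult_subset [of "Y * G" m k "inverse_mat G"] Y Gc by simp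
qed (rule GL_orbit_mult_subset [OF assms])

context index_split
begin

abbreviation chart_domain :: "real mat set set" where
  "chart_domain \<equiv> fst (grassmann_chart k m J)"

abbreviation chart_map :: "real mat set \<Rightarrow> nat \<Rightarrow> real" where
  "chart_map \<equiv> snd (grassmann_chart k m J)"

text \<open>
  The representative normalized to be the identity on the rows in \<open>J\<close>.
\<close>

definition frame :: "real mat \<Rightarrow> real mat" where
  "frame X = stack_rows k (1\<^sub>m k) X"

definition chart_inverse :: "(nat \<Rightarrow> real) \<Rightarrow> real mat set" where
  "chart_inverse x = GL_orbit k (frame (mat_of_coords (m - k) k x))"

lemma det_rows_mult:
  assumes Y: "Y \<in> carrier_mat m k" and G: "G \<in> carrier_mat k k"
  shows "det (rows_J (Y * G)) = det (rows_J Y) * det G"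
  using rows_mult(1) [OF Y G] det_mult [OF rows_carrier(1) [OF Y] G] by simp

lemma frame_carrier: "frame X \<in> carrier_mat m k"
  by (simp add: frame_def)

lemma rows_frame:
  assumes "X \<in> carrier_mat (m - k) k"
  shows "rows_J (frame X) = 1\<^sub>m k" "rows_compl (frame X) = X"
  using rows_stack_rows [of "1\<^sub>m k" k X] assms by (simp_all add: frame_def)

lemma frame_in_stiefel:
  assumes "X \<in> carrier_mat (m - k) k"
  shows "frame X \<in> stiefel m k"
  by (rule minor_nonzero_imp_stiefel [OF frame_carrier]) (simp add: rows_frame [OF assms])

text \<open>
  Changing the representative multiplies the minor by a nonzero determinant, so one representative
  decides.
\<close>

lemma orbit_in_chart_domain_iff:
  assumes Y: "Y \<in> stiefel m k"
  shows "GL_orbit k Y \<in> chart_domain \<longleftrightarrow> det (rows_J Y) \<noteq> 0"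
proof
  have Yc: "Y \<in> carrier_mat m k"
    using Y by (simp add: stiefel_def)
  show "det (rows_J Y) \<noteq> 0" if "GL_orbit k Y \<in> chart_domain"
    using that GL_orbit_self [OF Yc] invertible_mat_iff_det_nonzero [OF rows_carrier(1) [OF Yc]]
    by (simp add: grassmann_chart_def)
  assume nz: "det (rows_J Y) \<noteq> 0"
  have "invertible_mat (rows_J Z)" if Z: "Z \<in> GL_orbit k Y" for Z
  proof -
    obtain G where G: "G \<in> carrier_mat k k" "det G \<noteq> 0" "Z = Y * G"
      using Z by (auto simp: GL_orbit_def GL_mat_eq)
    then have "det (rows_J Z) \<noteq> 0" "Z \<in> carrier_mat m k"
      using det_rows_mult [OF Yc G(1)] nz Yc by auto
    then show ?thesis
      using invertible_mat_iff_det_nonzero [OF rows_carrier(1)] by blast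
  qed
  then show "GL_orbit k Y \<in> chart_domain"
    using Y by (simp add: grassmann_chart_def grassmannian_def)
qed

lemma chart_domainE:
  assumes "c \<in> chart_domain"
  obtains Y where "Y \<in> carrier_mat m k" "det (rows_J Y) \<noteq> 0" "c = GL_orbit k Y"
proof -
  obtain Y where Y: "Y \<in> stiefel m k" "c = GL_orbit k Y"
    using assms by (auto simp: grassmann_chart_def grassmannian_def)
  moreover have "det (rows_J Y) \<noteq> 0"
    using assms orbit_in_chart_domain_iff [OF Y(1)] Y(2) by simp
  ultimately show ?thesis
    using that by (auto simp: stiefel_def)
qed

text \<open>
  If \<open>X Y\<^sub>J = Y\<^sub>J\<^sub>c\<close> for one representative, then \<open>X (Y G)\<^sub>J = X Y\<^sub>J G = Y\<^sub>J\<^sub>c G = (Y G)\<^sub>J\<^sub>c\<close> for all of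
  them, and \<open>X\<close> is unique because \<open>Y\<^sub>J\<close> is invertible.
\<close>

lemma chart_map_orbit:
  assumes Y: "Y \<in> carrier_mat m k" and nz: "det (rows_J Y) \<noteq> 0"
  shows "chart_map (GL_orbit k Y) =
    mat_coords (m - k) k (rows_compl Y * inverse_mat (rows_J Y))"
proof -
  note YJ = rows_carrier(1) [OF Y] and YC = rows_carrier(2) [OF Y]
  note inv = inverse_mat [OF YJ nz]
  let ?X = "rows_compl Y * inverse_mat (rows_J Y)"
  have X: "?X \<in> carrier_mat (m - k) k"
    using YC inv(1) by simp
  have XY: "?X * rows_J Y = rows_compl Y"
    using assoc_mult_mat [OF YC inv(1) YJ] inv(3) YC by simp
  have "(THE X. X \<in> carrier_mat (m - k) k \<and>
      (\<forall>Z\<in>GL_orbit k Y. X * rows_J Z = rows_compl Z)) = ?X"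
  proof (rule the_equality)
    have "?X * rows_J Z = rows_compl Z" if "Z \<in> GL_orbit k Y" for Z
    proof -
      obtain G where G: "G \<in> carrier_mat k k" "Z = Y * G"
        using \<open>Z \<in> GL_orbit k Y\<close> by (auto simp: GL_orbit_def GL_mat_eq)
      then show ?thesis
        using rows_mult [OF Y G(1)] assoc_mult_mat [OF X YJ G(1)] XY by simp
    qed
    with X show "?X \<in> carrier_mat (m - k) k \<and> (\<forall>Z\<in>GL_orbit k Y. ?X * rows_J Z = rows_compl Z)"
      by blast
  next
    fix X' assume X': "X' \<in> carrier_mat (m - k) k \<and>
      (\<forall>Z\<in>GL_orbit k Y. X' * rows_J Z = rows_compl Z)"
    then have X'c: "X' \<in> carrier_mat (m - k) k"
      by blast
    from X' have "X' * rows_J Y = rows_compl Y"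
      using GL_orbit_self [OF Y] by blast
    then have "?X = X' * rows_J Y * inverse_mat (rows_J Y)"
      by simp
    also have "\<dots> = X'"
      using assoc_mult_mat [OF X'c YJ inv(1)] inv(2) right_mult_one_mat [OF X'c] by simp
    finally show "X' = ?X" ..
  qed
  then show ?thesis
    by (simp add: grassmann_chart_def)
qed

lemma chart_inverse_in_domain: "chart_inverse x \<in> chart_domain"
  using orbit_in_chart_domain_iff [OF frame_in_stiefel] rows_frame(1)
  by (simp add: chart_inverse_def)

lemma chart_map_chart_inverse:
  assumes "x \<in> topspace (Euclidean_space ((m - k) * k))"
  shows "chart_map (chart_inverse x) = x"
  using chart_map_orbit [OF frame_carrier, of "mat_of_coords (m - k) k x"] assms
  by (simp add: rows_frame chart_inverse_def right_mult_one_mat [OF mat_of_coords_carrier])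

lemma chart_map_in_Euclidean_space:
  "chart_map c \<in> topspace (Euclidean_space ((m - k) * k))"
  by (simp add: grassmann_chart_def)

text \<open>
  A representative \<open>Y\<close> equals its normalized form times \<open>Y\<^sub>J\<close>, so both have the same class.
\<close>

lemma chart_inverse_chart_map:
  assumes "c \<in> chart_domain"
  shows "chart_inverse (chart_map c) = c"
proof -
  obtain Y where Y: "Y \<in> carrier_mat m k" "det (rows_J Y) \<noteq> 0" and c: "c = GL_orbit k Y"
    using assms by (rule chart_domainE)
  note YJ = rows_carrier(1) [OF Y(1)] and YC = rows_carrier(2) [OF Y(1)]
  note inv = inverse_mat [OF YJ Y(2)]
  let ?X = "rows_compl Y * inverse_mat (rows_J Y)"
  have X: "?X \<in> carrier_mat (m - k) k"
    using YC inv(1) by simp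
  have "frame ?X * rows_J Y = stack_rows k (rows_J Y) (?X * rows_J Y)"
    unfolding frame_def using stack_rows_mult [OF one_carrier_mat X YJ] left_mult_one_mat [OF YJ] by simp
  also have "?X * rows_J Y = rows_compl Y"
    using assoc_mult_mat [OF YC inv(1) YJ] inv(3) YC by simp
  finally have "frame ?X * rows_J Y = Y"
    using stack_rows_rows [OF Y(1)] by simp
  moreover have "rows_J Y \<in> GL_mat k"
    using YJ Y(2) by (simp add: GL_mat_eq)
  ultimately have "GL_orbit k (frame ?X) = c"
    using GL_orbit_mult [OF frame_carrier, of "rows_J Y" ?X] by (simp add: c)
  moreover have "mat_of_coords (m - k) k (chart_map c) = ?X"
    unfolding c chart_map_orbit [OF Y] by (rule mat_of_coords_mat_coords [OF X])
  ultimately show ?thesis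
    by (simp add: chart_inverse_def)
qed

lemma rational_mat_frame:
  assumes "rational_mat d W (m - k) k F"
  shows "rational_mat d W m k (\<lambda>x. frame (F x))"
  unfolding frame_def
proof (rule rational_mat_stack_rows [OF _ assms])
  show "rational_mat d W k k (\<lambda>x. 1\<^sub>m k)"
    by (rule rational_matI [where f = "\<lambda>x i j. if i = j then 1 else 0"]) (simp_all add: rational_on.const)
qed

lemma rational_on_minor:
  "rational_on (m * k) (mat_coords m k ` S) (\<lambda>x. det (rows_J (mat_of_coords m k x)))"
  by (rule rational_on_det [OF rational_mat_rows(1) [OF rational_mat_mat_of_coords_image]])

lemma openin_chart_domain: "openin (grassmann_topology k m) chart_domain"
proof -
  let ?S = "subtopology (mat_topology m k) (stiefel m k)"
  have "continuous_map ?S euclideanreal (\<lambda>Y. det (rows_J Y))"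
    by (rule rational_imp_continuous_map_mat [OF rational_on_minor]) (auto simp: stiefel_def)
  then have "openin ?S {Y \<in> topspace ?S. det (rows_J Y) \<in> - {0}}"
    by (rule openin_continuous_map_preimage) auto
  then have "openin ?S {Y \<in> stiefel m k. GL_orbit k Y \<in> chart_domain}"
    unfolding topspace_stiefel
    by (simp add: orbit_in_chart_domain_iff cong: conj_cong)
  then show ?thesis
    by (auto simp: openin_grassmann_topology grassmann_chart_def)
qed

text \<open>
  Over the open chart domain the projection from the Stiefel manifold is still a quotient map.
  Hence the chart is continuous because \<open>Y\<^sub>J\<^sub>c Y\<^sub>J\<^sup>-\<^sup>1\<close> depends continuously on \<open>Y\<close>, and its inverse is the
  continuous map to the normalized representative followed by the projection.
\<close>

lemma homeomorphic_maps_chart: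
  "homeomorphic_maps (subtopology (grassmann_topology k m) chart_domain)
     (Euclidean_space ((m - k) * k)) chart_map chart_inverse"
proof -
  let ?G = "grassmann_topology k m" and ?E = "Euclidean_space ((m - k) * k)"
  let ?M = "mat_topology m k"
  let ?S = "{Y \<in> stiefel m k. det (rows_J Y) \<noteq> 0}"
  have S: "?S \<subseteq> carrier_mat m k"
    by (auto simp: stiefel_def)
  have "quotient_map (subtopology (subtopology ?M (stiefel m k)) ?S)
      (subtopology ?G chart_domain) (GL_orbit k)"
    by (rule quotient_map_restriction [OF quotient_map_GL_orbit])
       (use openin_chart_domain in \<open>auto simp only: topspace_stiefel orbit_in_chart_domain_iff\<close>)
  then have quot: "quotient_map (subtopology ?M ?S) (subtopology ?G chart_domain) (GL_orbit k)"
    by (simp add: subtopology_subtopology Int_absorb1 subset_iff)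
  have "continuous_map (subtopology ?M ?S) ?E
      (\<lambda>Y. mat_coords (m - k) k (rows_compl Y * inverse_mat (rows_J Y)))"
  proof (rule rational_imp_continuous_map_mat_Euclidean [OF _ S])
    note rows = rational_mat_rows [OF rational_mat_mat_of_coords_image [of m k ?S]]
    have "det (rows_J (mat_of_coords m k x)) \<noteq> 0" if "x \<in> mat_coords m k ` ?S" for x
      using S that by auto
    from rational_map_mat_coords [OF rational_mat_mult [OF rows(2) rational_mat_inverse_mat [OF rows(1) this]]]
    show "rational_map (m * k) (mat_coords m k ` ?S) ((m - k) * k)
        (\<lambda>x. mat_coords (m - k) k (rows_compl (mat_of_coords m k x) *
           inverse_mat (rows_J (mat_of_coords m k x))))" .
  qed
  then have "continuous_map (subtopology ?M ?S) ?E (chart_map \<circ> GL_orbit k)"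
    by (rule continuous_map_eq) (use S chart_map_orbit in auto)
  then have "continuous_map (subtopology ?G chart_domain) ?E chart_map"
    using quot by (rule continuous_compose_quotient_map [rotated])
  moreover have "continuous_map ?E (subtopology ?G chart_domain) chart_inverse"
  proof -
    have "continuous_map ?E ?M (\<lambda>x. frame (mat_of_coords (m - k) k x))"
      by (intro continuous_map_into_mat_topology rational_mat_frame rational_mat_mat_of_coords
          rational_map_id subset_refl)
    then have "continuous_map ?E (subtopology ?M (stiefel m k)) (\<lambda>x. frame (mat_of_coords (m - k) k x))"
      using frame_in_stiefel by (auto simp: continuous_map_in_subtopology)
    from continuous_map_compose [OF this quotient_imp_continuous_map [OF quotient_map_GL_orbit]]
    show ?thesis
      using chart_inverse_in_domain
      by (simp add: continuous_map_in_subtopology chart_inverse_def [abs_def] comp_def)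
  qed
  ultimately show ?thesis
    using chart_map_chart_inverse chart_inverse_chart_map by (simp add: homeomorphic_maps_def)
qed

lemma full_chart_grassmann:
  "full_chart ((m - k) * k) (grassmann_topology k m) (grassmann_chart k m J)"
  using homeomorphic_maps_chart openin_chart_domain
  by (auto simp: full_chart_def case_prod_beta homeomorphic_map_maps)

lemma inv_into_chart_map:
  assumes "x \<in> topspace (Euclidean_space ((m - k) * k))"
  shows "inv_into chart_domain chart_map x = chart_inverse x"
proof (rule inv_into_f_eq)
  show "inj_on chart_map chart_domain"
    using full_chart_grassmann full_chart_inj_on by (metis prod.collapse)
qed (use chart_inverse_in_domain chart_map_chart_inverse assms in auto)

end

text \<open>
  The transition map evaluates the second chart at the normalized representative of the first, so
  it consists of block extraction, matrix inversion and multiplication.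
\<close>

lemma rational_transition_grassmann:
  assumes "index_split m k J" and "index_split m k J'"
  shows "rational_transition ((m - k) * k) (grassmann_chart k m J) (grassmann_chart k m J')"
proof -
  interpret A: index_split m k J by fact
  interpret B: index_split m k J' by fact
  let ?d = "(m - k) * k"
  let ?W = "A.chart_map ` (A.chart_domain \<inter> B.chart_domain)"
  let ?F = "\<lambda>x. A.frame (mat_of_coords (m - k) k x)"
  have W: "?W \<subseteq> topspace (Euclidean_space ?d)"
    using A.chart_map_in_Euclidean_space by blast
  have nz: "det (B.rows_J (?F x)) \<noteq> 0" if "x \<in> ?W" for x
  proof -
    have "A.chart_inverse x \<in> B.chart_domain"
      using that A.chart_inverse_chart_map by auto
    then show ?thesis
      using B.orbit_in_chart_domain_iff [OF A.frame_in_stiefel [OF mat_of_coords_carrier]]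
      by (simp add: A.chart_inverse_def)
  qed
  have F: "rational_mat ?d ?W m k ?F"
    by (intro A.rational_mat_frame rational_mat_mat_of_coords rational_map_id W)
  have "rational_map ?d ?W ?d
      (\<lambda>x. mat_coords (m - k) k (B.rows_compl (?F x) * inverse_mat (B.rows_J (?F x))))"
    using rational_map_mat_coords [OF rational_mat_mult [OF B.rational_mat_rows(2) [OF F]
          rational_mat_inverse_mat [OF B.rational_mat_rows(1) [OF F] nz]]] .
  then have "rational_map ?d ?W ?d (B.chart_map \<circ> inv_into A.chart_domain A.chart_map)"
  proof (rule rational_map_cong)
    fix x assume x: "x \<in> ?W"
    show "mat_coords (m - k) k (B.rows_compl (?F x) * inverse_mat (B.rows_J (?F x))) =
        (B.chart_map \<circ> inv_into A.chart_domain A.chart_map) x"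
      using B.chart_map_orbit [OF A.frame_carrier nz [OF x]] A.inv_into_chart_map [of x] x W
      by (simp add: A.chart_inverse_def subset_iff)
  qed
  then show ?thesis
    by (simp add: rational_transition_def case_prod_beta)
qed

lemma grassmannian_chart_cover:
  assumes "c \<in> grassmannian k m"
  obtains J where "index_split m k J" "c \<in> fst (grassmann_chart k m J)"
proof -
  obtain Y where Y: "Y \<in> stiefel m k" "c = GL_orbit k Y"
    using assms by (auto simp: grassmannian_def)
  obtain J where J: "J \<subseteq> {..<m}" "card J = k" "det (submatrix Y J UNIV) \<noteq> 0"
    using Y(1) by (rule stiefel_imp_minor_nonzero)
  interpret index_split m k J
    using J by unfold_locales
  show ?thesis
    using that [OF index_split_axioms] orbit_in_chart_domain_iff [OF Y(1)] J(3) Y(2) by simp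
qed

text \<open>
  A change of representative multiplies all maximal minors by the same factor, so this quotient is
  a function of the class.  It vanishes exactly outside the chart domain of \<open>J\<close>.
\<close>

definition minor_ratio :: "nat \<Rightarrow> nat \<Rightarrow> nat set \<Rightarrow> real mat \<Rightarrow> real" where
  "minor_ratio m k J Y = (det (submatrix Y J UNIV))\<^sup>2 /
     (\<Sum>K | K \<subseteq> {..<m} \<and> card K = k. (det (submatrix Y K UNIV))\<^sup>2)"

lemma sum_minors_pos:
  assumes "Y \<in> stiefel m k"
  shows "(\<Sum>K | K \<subseteq> {..<m} \<and> card K = k. (det (submatrix Y K UNIV))\<^sup>2) > 0"
proof -
  obtain J where "J \<subseteq> {..<m}" "card J = k" "det (submatrix Y J UNIV) \<noteq> 0"
    using assms by (rule stiefel_imp_minor_nonzero)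
  moreover have "finite {K. K \<subseteq> {..<m} \<and> card K = k}"
    by (rule finite_subset [of _ "Pow {..<m}"]) auto
  ultimately show ?thesis
    by (intro sum_pos2 [of _ J]) auto
qed

lemma minor_ratio_mult:
  assumes J: "J \<subseteq> {..<m}" "card J = k" and Y: "Y \<in> carrier_mat m k"
    and G: "G \<in> carrier_mat k k" "det G \<noteq> 0"
  shows "minor_ratio m k J (Y * G) = minor_ratio m k J Y"
proof -
  have *: "det (submatrix (Y * G) K UNIV) = det (submatrix Y K UNIV) * det G"
    if "K \<subseteq> {..<m}" "card K = k" for K
  proof -
    interpret index_split m k K
      using that by unfold_locales
    show ?thesis
      by (rule det_rows_mult [OF Y G(1)])
  qed
  have "(\<Sum>K | K \<subseteq> {..<m} \<and> card K = k. (det (submatrix (Y * G) K UNIV))\<^sup>2) =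
      (\<Sum>K | K \<subseteq> {..<m} \<and> card K = k. (det (submatrix Y K UNIV))\<^sup>2) * (det G)\<^sup>2"
    unfolding sum_distrib_right by (rule sum.cong) (auto simp: * power_mult_distrib)
  then show ?thesis
    using G(2) J by (simp add: minor_ratio_def * power_mult_distrib)
qed

text \<open>
  The value at an arbitrary representative; \<open>class_minor_ratio_orbit\<close> shows that the choice is immaterial.
\<close>

definition class_minor_ratio :: "nat \<Rightarrow> nat \<Rightarrow> nat set \<Rightarrow> real mat set \<Rightarrow> real" where
  "class_minor_ratio m k J c = minor_ratio m k J (SOME Y. Y \<in> c)"

lemma class_minor_ratio_orbit:
  assumes J: "J \<subseteq> {..<m}" "card J = k" and Y: "Y \<in> carrier_mat m k"
  shows "class_minor_ratio m k J (GL_orbit k Y) = minor_ratio m k J Y"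
proof -
  have "(SOME Z. Z \<in> GL_orbit k Y) \<in> GL_orbit k Y"
    using GL_orbit_self [OF Y] by (rule someI)
  then obtain G where "G \<in> carrier_mat k k" "det G \<noteq> 0" "(SOME Z. Z \<in> GL_orbit k Y) = Y * G"
    by (auto simp: GL_orbit_def GL_mat_eq)
  then show ?thesis
    using minor_ratio_mult [OF J Y] by (simp add: class_minor_ratio_def)
qed

lemma continuous_map_class_minor_ratio:
  assumes J: "J \<subseteq> {..<m}" "card J = k"
  shows "continuous_map (grassmann_topology k m) euclideanreal (class_minor_ratio m k J)"
proof (rule continuous_compose_quotient_map [OF quotient_map_GL_orbit])
  let ?S = "stiefel m k"
  have S: "?S \<subseteq> carrier_mat m k"
    by (auto simp: stiefel_def)
  have minor: "rational_on (m * k) (mat_coords m k ` ?S) (\<lambda>x. det (submatrix (mat_of_coords m k x) K UNIV))"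
    if "K \<subseteq> {..<m}" "card K = k" for K
    by (rule index_split.rational_on_minor) (use that in unfold_locales)
  have "continuous_map (subtopology (mat_topology m k) ?S) euclideanreal (minor_ratio m k J)"
  proof (rule rational_imp_continuous_map_mat [OF _ S])
    show "rational_on (m * k) (mat_coords m k ` ?S) (\<lambda>x. minor_ratio m k J (mat_of_coords m k x))"
      unfolding minor_ratio_def power2_eq_square
    proof (intro rational_on_divide rational_on_sum rational_on.mult minor J ballI)
      fix x assume "x \<in> mat_coords m k ` ?S"
      then have "mat_of_coords m k x \<in> ?S"
        using S by auto
      from sum_minors_pos [OF this]
      show "(\<Sum>K | K \<subseteq> {..<m} \<and> card K = k. det (submatrix (mat_of_coords m k x) K UNIV) *
          det (submatrix (mat_of_coords m k x) K UNIV)) \<noteq> 0"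
        by (simp add: power2_eq_square)
    qed auto
  qed
  then show "continuous_map (subtopology (mat_topology m k) ?S) euclideanreal
      (class_minor_ratio m k J \<circ> GL_orbit k)"
    by (rule continuous_map_eq) (use S class_minor_ratio_orbit [OF J] in auto)
qed

lemma (in index_split) class_minor_ratio_nonzero_iff:
  assumes "c \<in> grassmannian k m"
  shows "class_minor_ratio m k J c \<noteq> 0 \<longleftrightarrow> c \<in> chart_domain"
proof -
  obtain Y where Y: "Y \<in> stiefel m k" "c = GL_orbit k Y"
    using assms by (auto simp: grassmannian_def)
  then have "Y \<in> carrier_mat m k"
    by (simp add: stiefel_def)
  then show ?thesis
    using class_minor_ratio_orbit [OF J_subset card_J] sum_minors_pos [OF Y(1)]
      orbit_in_chart_domain_iff [OF Y(1)] Y(2) by (simp add: minor_ratio_def)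
qed

text \<open>
  Let \<open>c\<close> lie in the chart domain of \<open>J\<close>.  If \<open>c'\<close> does so too, both are separated inside that open
  set, which is homeomorphic to a Euclidean space.  Otherwise the minor ratio of \<open>J\<close> is
  nonzero at \<open>c\<close> and zero at \<open>c'\<close>.
\<close>

lemma Hausdorff_space_grassmann: "Hausdorff_space (grassmann_topology k m)"
  unfolding Hausdorff_space_def topspace_grassmann_topology
proof (intro allI impI, elim conjE)
  let ?G = "grassmann_topology k m"
  fix c c' assume c: "c \<in> grassmannian k m" and c': "c' \<in> grassmannian k m" and "c \<noteq> c'"
  obtain J where J: "index_split m k J" and cJ: "c \<in> fst (grassmann_chart k m J)"
    using c by (rule grassmannian_chart_cover)
  interpret index_split m k J by fact
  show "\<exists>U V. openin ?G U \<and> openin ?G V \<and> c \<in> U \<and> c' \<in> V \<and> disjnt U V"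
  proof (cases "c' \<in> chart_domain")
    case True
    have "subtopology ?G chart_domain homeomorphic_space Euclidean_space ((m - k) * k)"
      using homeomorphic_maps_chart homeomorphic_maps_imp_homeomorphic_space by blast
    then have "Hausdorff_space (subtopology ?G chart_domain)"
      using homeomorphic_Hausdorff_space Hausdorff_space_Euclidean_space by blast
    moreover have "topspace (subtopology ?G chart_domain) = chart_domain"
      using openin_subset [OF openin_chart_domain] by auto
    ultimately obtain U V where "openin (subtopology ?G chart_domain) U"
      "openin (subtopology ?G chart_domain) V" "c \<in> U" "c' \<in> V" "disjnt U V"
      using cJ True \<open>c \<noteq> c'\<close> unfolding Hausdorff_space_def by metis
    moreover from this have "openin ?G U" "openin ?G V"
      by (simp_all add: openin_open_subtopology [OF openin_chart_domain])
    ultimately show ?thesis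
      by (intro exI [of _ U] exI [of _ V] conjI)
  next
    case False
    let ?h = "class_minor_ratio m k J"
    have ne: "?h c \<noteq> ?h c'"
      using class_minor_ratio_nonzero_iff [OF c] class_minor_ratio_nonzero_iff [OF c'] cJ False by simp
    then obtain U V where UV: "open U" "open V" "?h c \<in> U" "?h c' \<in> V" "U \<inter> V = {}"
      using hausdorff [OF ne] by (elim exE conjE) (rule that)
    let ?pre = "\<lambda>U. {x \<in> topspace ?G. ?h x \<in> U}"
    have "openin ?G (?pre U)" "openin ?G (?pre V)"
      using openin_continuous_map_preimage [OF continuous_map_class_minor_ratio [OF J_subset card_J]]
        UV(1,2) by auto
    moreover have "c \<in> ?pre U" "c' \<in> ?pre V" "disjnt (?pre U) (?pre V)"
      using UV c c' by (auto simp: disjnt_def topspace_grassmann_topology)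
    ultimately show ?thesis
      by blast
  qed
qed

lemma rational_manifold_grassmann: "rational_manifold (grassmann_manifold k m)"
proof -
  let ?\<J> = "{J. J \<subseteq> {..<m} \<and> card J = k}"
  let ?G = "grassmann_topology k m"
  have atlas: "mfd_atlas (grassmann_manifold k m) = grassmann_chart k m ` ?\<J>"
    by (auto simp: grassmann_manifold_def)
  have split: "index_split m k J \<longleftrightarrow> J \<in> ?\<J>" for J
    by (simp add: index_split_def)
  have "finite ?\<J>"
    by (rule finite_subset [of _ "Pow {..<m}"]) auto
  then have finite: "finite (mfd_atlas (grassmann_manifold k m))"
    by (simp add: atlas)
  have "(\<Union>J\<in>?\<J>. fst (grassmann_chart k m J)) = grassmannian k m"
  proof (intro subset_antisym subsetI)
    fix c assume "c \<in> grassmannian k m"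
    then obtain J where "index_split m k J" "c \<in> fst (grassmann_chart k m J)"
      by (rule grassmannian_chart_cover)
    then show "c \<in> (\<Union>J\<in>?\<J>. fst (grassmann_chart k m J))"
      by (simp only: split) (rule UN_I)
  qed (simp add: grassmann_chart_def)
  then have cover: "(\<Union>(U, \<phi>) \<in> mfd_atlas (grassmann_manifold k m). U) = topspace ?G"
    by (simp add: atlas case_prod_beta topspace_grassmann_topology)
  show ?thesis
    unfolding rational_manifold_def
  proof (intro conjI ballI)
    show "Hausdorff_space (mfd_top (grassmann_manifold k m))"
      by (simp add: grassmann_manifold_def Hausdorff_space_grassmann)
    show "(\<Union>(U, \<phi>) \<in> mfd_atlas (grassmann_manifold k m). U) = topspace (mfd_top (grassmann_manifold k m))"
      using cover by (simp add: grassmann_manifold_def)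
  next
    fix c assume "c \<in> mfd_atlas (grassmann_manifold k m)"
    then obtain J where J: "index_split m k J" "c = grassmann_chart k m J"
      unfolding atlas split by blast
    then show "full_chart (mfd_dim (grassmann_manifold k m)) (mfd_top (grassmann_manifold k m)) c"
      using index_split.full_chart_grassmann by (simp add: grassmann_manifold_def)
    fix c' assume "c' \<in> mfd_atlas (grassmann_manifold k m)"
    then obtain J' where "index_split m k J'" "c' = grassmann_chart k m J'"
      unfolding atlas split by blast
    then show "rational_transition (mfd_dim (grassmann_manifold k m)) c c'"
      using J rational_transition_grassmann by (simp add: grassmann_manifold_def)
  qed (rule finite)
qed


section \<open>Slice charts\<close>

lemma mat_coords_eq_zero_iff:
  assumes "B \<in> carrier_mat n l"
  shows "mat_coords n l B \<in> topspace (Euclidean_space 0) \<longleftrightarrow> B = 0\<^sub>m n l"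
proof
  assume "mat_coords n l B \<in> topspace (Euclidean_space 0)"
  then have "mat_coords n l B = mat_coords n l (0\<^sub>m n l)"
    using div_mod_less [of _ n l] by (auto simp: topspace_Euclidean_space mat_coords_def)
  then show "B = 0\<^sub>m n l"
    by (metis assms mat_of_coords_mat_coords zero_carrier_mat)
next
  show "mat_coords n l B \<in> topspace (Euclidean_space 0)" if "B = 0\<^sub>m n l"
    using that div_mod_less [of _ n l] by (simp add: topspace_Euclidean_space mat_coords_def)
qed

lemma join_coords_in_slice_iff:
  assumes "x \<in> topspace (Euclidean_space d)"
  shows "join_coords d x y \<in> topspace (Euclidean_space (d + e)) \<longleftrightarrow> y \<in> topspace (Euclidean_space e)"
proof
  assume "join_coords d x y \<in> topspace (Euclidean_space (d + e))"
  then show "y \<in> topspace (Euclidean_space e)"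
    using drop_coords_in_Euclidean_space by fastforce
qed (rule join_coords_in_Euclidean_space)

context index_split
begin

text \<open>
  In matrix terms, \<open>(A, X) \<mapsto> (A\<^sub>J\<^sub>c, X, A\<^sub>J + A\<^sub>J\<^sub>c X)\<close>, and below its inverse
  \<open>(A\<^sub>J\<^sub>c, X, B) \<mapsto> (A, X)\<close> with \<open>A\<^sub>J = B - A\<^sub>J\<^sub>c X\<close>.  The block that vanishes on the set of pairs
  comes last, as the definition of a slice requires.
\<close>

definition straighten :: "nat \<Rightarrow> (nat \<Rightarrow> real) \<Rightarrow> nat \<Rightarrow> real" where
  "straighten n z =
     (let A = mat_of_coords n m (take_coords (n * m) z);
          X = mat_of_coords (m - k) k (drop_coords (n * m) z)
      in join_coords (n * (m - k)) (mat_coords n (m - k) (cols_compl A))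
           (join_coords ((m - k) * k) (mat_coords (m - k) k X)
              (mat_coords n k (cols_J A + cols_compl A * X))))"

definition unstraighten :: "nat \<Rightarrow> (nat \<Rightarrow> real) \<Rightarrow> nat \<Rightarrow> real" where
  "unstraighten n z =
     (let A1 = mat_of_coords n (m - k) (take_coords (n * (m - k)) z);
          y = drop_coords (n * (m - k)) z;
          X = mat_of_coords (m - k) k (take_coords ((m - k) * k) y);
          B = mat_of_coords n k (drop_coords ((m - k) * k) y)
      in join_coords (n * m) (mat_coords n m (stack_cols n (B - A1 * X) A1))
           (mat_coords (m - k) k X))"

lemma dim_split: "n * m + (m - k) * k = n * (m - k) + ((m - k) * k + n * k)"
proof -
  have "n * m = n * (m - k) + n * k"
    using k_le_m by (simp flip: distrib_left)
  then show ?thesis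
    by simp
qed

lemma straighten_join:
  assumes "A \<in> carrier_mat n m" "X \<in> carrier_mat (m - k) k"
  shows "straighten n (join_coords (n * m) (mat_coords n m A) (mat_coords (m - k) k X)) =
      join_coords (n * (m - k)) (mat_coords n (m - k) (cols_compl A))
           (join_coords ((m - k) * k) (mat_coords (m - k) k X)
              (mat_coords n k (cols_J A + cols_compl A * X)))"
  using assms by (simp add: straighten_def)

lemma unstraighten_join:
  assumes "A1 \<in> carrier_mat n (m - k)" "X \<in> carrier_mat (m - k) k" "B \<in> carrier_mat n k"
  shows "unstraighten n (join_coords (n * (m - k)) (mat_coords n (m - k) A1)
           (join_coords ((m - k) * k) (mat_coords (m - k) k X) (mat_coords n k B))) =
      join_coords (n * m) (mat_coords n m (stack_cols n (B - A1 * X) A1)) (mat_coords (m - k) k X)"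
  using assms by (simp add: unstraighten_def)

lemma unstraighten_straighten:
  assumes "z \<in> topspace (Euclidean_space (n * m + (m - k) * k))"
  shows "unstraighten n (straighten n z) = z"
proof -
  define A where "A = mat_of_coords n m (take_coords (n * m) z)"
  define X where "X = mat_of_coords (m - k) k (drop_coords (n * m) z)"
  have AX: "A \<in> carrier_mat n m" "X \<in> carrier_mat (m - k) k"
    by (simp_all add: A_def X_def)
  note cols = cols_carrier [OF AX(1)]
  have z: "z = join_coords (n * m) (mat_coords n m A) (mat_coords (m - k) k X)"
    using drop_coords_in_Euclidean_space [OF assms]
    by (simp add: A_def X_def take_coords_in_Euclidean_space)
  have "cols_J A + cols_compl A * X - cols_compl A * X = cols_J A"
    using cols AX by (intro eq_matI) auto
  then show ?thesis
    unfolding z straighten_join [OF AX]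
    using unstraighten_join [OF cols(2) AX(2), of "cols_J A + cols_compl A * X"] cols AX
    by (simp add: stack_cols_cols [OF AX(1)])
qed

lemma straighten_unstraighten:
  assumes "z \<in> topspace (Euclidean_space (n * m + (m - k) * k))"
  shows "straighten n (unstraighten n z) = z"
proof -
  define A1 where "A1 = mat_of_coords n (m - k) (take_coords (n * (m - k)) z)"
  define y where "y = drop_coords (n * (m - k)) z"
  define X where "X = mat_of_coords (m - k) k (take_coords ((m - k) * k) y)"
  define B where "B = mat_of_coords n k (drop_coords ((m - k) * k) y)"
  have carr: "A1 \<in> carrier_mat n (m - k)" "X \<in> carrier_mat (m - k) k" "B \<in> carrier_mat n k"
    by (simp_all add: A1_def X_def B_def)
  have y: "y \<in> topspace (Euclidean_space ((m - k) * k + n * k))"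
    using assms unfolding dim_split y_def by (rule drop_coords_in_Euclidean_space)
  have "y = join_coords ((m - k) * k) (mat_coords (m - k) k X) (mat_coords n k B)"
    using drop_coords_in_Euclidean_space [OF y]
    by (simp add: X_def B_def take_coords_in_Euclidean_space)
  moreover have "z = join_coords (n * (m - k)) (mat_coords n (m - k) A1) y"
    by (simp add: A1_def y_def take_coords_in_Euclidean_space)
  ultimately have z: "z = join_coords (n * (m - k)) (mat_coords n (m - k) A1)
      (join_coords ((m - k) * k) (mat_coords (m - k) k X) (mat_coords n k B))"
    by simp
  have BAX: "B - A1 * X \<in> carrier_mat n k"
    by (rule minus_carrier_mat [OF mult_carrier_mat [OF carr(1,2)]])
  have "B - A1 * X + A1 * X = B"
    using carr by (intro eq_matI) auto
  then show ?thesis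
    unfolding z unstraighten_join [OF carr]
    using straighten_join [OF stack_carrier(2) carr(2)] cols_stack_cols [OF BAX carr(1)] by simp
qed

lemma rational_map_straighten:
  "rational_map (n * m + (m - k) * k) (topspace (Euclidean_space (n * m + (m - k) * k)))
     (n * m + (m - k) * k) (straighten n)"
proof -
  let ?d = "n * m + (m - k) * k"
  let ?E = "topspace (Euclidean_space ?d)"
  have id: "rational_map ?d ?E ?d (\<lambda>z. z)"
    by (rule rational_map_id [OF subset_refl])
  have A: "rational_mat ?d ?E n m (\<lambda>z. mat_of_coords n m (take_coords (n * m) z))"
    and X: "rational_mat ?d ?E (m - k) k (\<lambda>z. mat_of_coords (m - k) k (drop_coords (n * m) z))"
    by (rule rational_mat_mat_of_coords, rule rational_map_take_coords_comp [OF id],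
        rule rational_mat_mat_of_coords, rule rational_map_drop_coords_comp [OF id])
  have "rational_map ?d ?E (n * (m - k) + ((m - k) * k + n * k)) (straighten n)"
    unfolding straighten_def Let_def
    by (intro rational_map_join_coords rational_map_mat_coords rational_mat_add
        rational_mat_mult [OF rational_mat_cols(2)] rational_mat_cols A X)
  then show ?thesis
    by (simp only: dim_split)
qed

lemma rational_map_unstraighten:
  "rational_map (n * m + (m - k) * k) (topspace (Euclidean_space (n * m + (m - k) * k)))
     (n * m + (m - k) * k) (unstraighten n)"
proof -
  let ?d = "n * (m - k) + ((m - k) * k + n * k)"
  let ?E = "topspace (Euclidean_space ?d)"
  have id: "rational_map ?d ?E ?d (\<lambda>z. z)"
    by (rule rational_map_id [OF subset_refl])
  note y = rational_map_drop_coords_comp [OF id]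
  have A1: "rational_mat ?d ?E n (m - k) (\<lambda>z. mat_of_coords n (m - k) (take_coords (n * (m - k)) z))"
    by (rule rational_mat_mat_of_coords, rule rational_map_take_coords_comp [OF id])
  have X: "rational_mat ?d ?E (m - k) k (\<lambda>z. mat_of_coords (m - k) k
      (take_coords ((m - k) * k) (drop_coords (n * (m - k)) z)))"
    by (rule rational_mat_mat_of_coords, rule rational_map_take_coords_comp [OF y])
  have B: "rational_mat ?d ?E n k (\<lambda>z. mat_of_coords n k
      (drop_coords ((m - k) * k) (drop_coords (n * (m - k)) z)))"
    by (rule rational_mat_mat_of_coords, rule rational_map_drop_coords_comp [OF y])
  have "rational_map ?d ?E (n * m + (m - k) * k) (unstraighten n)"
    unfolding unstraighten_def Let_def
    by (intro rational_map_join_coords rational_map_mat_coords rational_mat_stack_cols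
        rational_mat_diff rational_mat_mult [OF A1] A1 X B)
  then show ?thesis
    by (simp only: dim_split)
qed

lemma annihilates_chart_inverse_iff:
  assumes A: "A \<in> carrier_mat n m"
  shows "(\<forall>Y\<in>chart_inverse x. A * Y = 0\<^sub>m n k) \<longleftrightarrow>
    cols_J A + cols_compl A * mat_of_coords (m - k) k x = 0\<^sub>m n k"
proof -
  let ?X = "mat_of_coords (m - k) k x"
  have "A * frame ?X = cols_J A + cols_compl A * ?X"
    using mult_stack_rows [OF A one_carrier_mat, of ?X] cols_carrier(1) [OF A]
    by (simp add: frame_def right_mult_one_mat)
  then show ?thesis
    unfolding chart_inverse_def
    using annihilates_class_iff [OF A frame_in_stiefel [of ?X]] by simp
qed

text \<open>
  Lying in the slice means that the last block of coordinates, the entries of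
  \<open>A\<^sub>J + A\<^sub>J\<^sub>c X\<close>, vanishes, and that matrix is \<open>A Y\<close> for the normalized representative \<open>Y\<close>.
\<close>

lemma slice_chart_in_slice_iff:
  assumes A: "A \<in> carrier_mat n m" and c: "c \<in> chart_domain"
  shows "straighten n (join_coords (n * m) (mat_coords n m A) (chart_map c))
      \<in> topspace (Euclidean_space (n * (m - k) + (m - k) * k)) \<longleftrightarrow>
    (\<forall>Y\<in>c. A * Y = 0\<^sub>m n k)"
proof -
  let ?X = "mat_of_coords (m - k) k (chart_map c)"
  let ?B = "cols_J A + cols_compl A * ?X"
  have B: "?B \<in> carrier_mat n k"
    using cols_carrier [OF A] by simp
  have "mat_coords (m - k) k ?X = chart_map c"
    by (rule mat_coords_mat_of_coords [OF chart_map_in_Euclidean_space])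
  then have "straighten n (join_coords (n * m) (mat_coords n m A) (chart_map c)) =
      join_coords (n * (m - k)) (mat_coords n (m - k) (cols_compl A))
        (join_coords ((m - k) * k) (chart_map c) (mat_coords n k ?B))"
    using straighten_join [OF A mat_of_coords_carrier, of "chart_map c"] by simp
  moreover have "join_coords ((m - k) * k) (chart_map c) (mat_coords n k ?B)
      \<in> topspace (Euclidean_space ((m - k) * k)) \<longleftrightarrow> mat_coords n k ?B \<in> topspace (Euclidean_space 0)"
    using join_coords_in_slice_iff [OF chart_map_in_Euclidean_space, of c _ 0] by simp
  ultimately show ?thesis
    using annihilates_chart_inverse_iff [OF A, of "chart_map c"] chart_inverse_chart_map [OF c]
      mat_coords_eq_zero_iff [OF B]
    by (simp add: join_coords_in_slice_iff)
qed

end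

theorem theorem2p2:
  fixes n m r :: nat
  assumes "1 \<le> n" and "1 \<le> m" and "r \<le> m"
  shows "embedded_submanifold
           (prod_manifold (mat_manifold n m) (grassmann_manifold (m - r) m))
           (M_hat n m r) ((n + m) * r - r\<^sup>2)"
proof -
  define k where "k = m - r"
  have r: "m - k = r"
    using \<open>r \<le> m\<close> by (simp add: k_def)
  let ?M = "prod_manifold (mat_manifold n m) (grassmann_manifold k m)"
  let ?S = "M_hat n m r"
  have S: "?S = {(A, c). A \<in> carrier_mat n m \<and> c \<in> grassmannian k m \<and> (\<forall>Y\<in>c. A * Y = 0\<^sub>m n k)}"
    by (simp add: M_hat_def k_def)
  have "(n + m) * r = n * r + r * k + r\<^sup>2"
  proof -
    have "m = r + k"
      using \<open>r \<le> m\<close> by (simp add: k_def)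
    then show ?thesis
      by (simp add: power2_eq_square algebra_simps)
  qed
  then have dim: "(n + m) * r - r\<^sup>2 = n * r + r * k"
    by simp
  have dim_M: "mfd_dim ?M = n * m + r * k"
    by (simp add: prod_manifold_def mat_manifold_def grassmann_manifold_def r)
  have M: "rational_manifold ?M"
    by (intro rational_manifold_prod rational_manifold_mat_manifold rational_manifold_grassmann)
  have slice: "\<exists>(U, \<phi>) \<in> maximal_atlas ?M.
      p \<in> U \<and> \<phi> ` (U \<inter> ?S) = \<phi> ` U \<inter> topspace (Euclidean_space (n * r + r * k))"
    if "p \<in> ?S" for p
  proof -
    have "snd p \<in> grassmannian k m" "fst p \<in> carrier_mat n m"
      using \<open>p \<in> ?S\<close> by (auto simp: S)
    then obtain J where J: "index_split m k J" and p: "snd p \<in> fst (grassmann_chart k m J)"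
      using grassmannian_chart_cover by blast
    interpret index_split m k J by fact
    let ?U = "carrier_mat n m \<times> chart_domain"
    let ?\<Phi> = "\<lambda>(A, c). join_coords (n * m) (mat_coords n m A) (chart_map c)"
    have "(carrier_mat n m, mat_coords n m) \<in> mfd_atlas (mat_manifold n m)"
      by (simp add: mat_manifold_def)
    moreover have "grassmann_chart k m J \<in> mfd_atlas (grassmann_manifold k m)"
      using J_subset card_J by (auto simp: grassmann_manifold_def)
    ultimately have "prod_chart (mfd_dim (mat_manifold n m)) (carrier_mat n m, mat_coords n m)
        (grassmann_chart k m J) \<in> mfd_atlas ?M"
      unfolding prod_manifold_def manifold.select_convs by blast
    moreover have "(?U, ?\<Phi>) = prod_chart (n * m) (carrier_mat n m, mat_coords n m) (grassmann_chart k m J)"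
      using prod_chart_eq [of "n * m" "carrier_mat n m" "mat_coords n m" chart_domain chart_map]
      by (simp only: prod.collapse)
    ultimately have "(?U, ?\<Phi>) \<in> mfd_atlas ?M"
      by (simp only: mat_manifold_def manifold.select_convs)
    then have max: "(?U, straighten n \<circ> ?\<Phi>) \<in> maximal_atlas ?M"
      using rational_map_straighten [of n] rational_map_unstraighten [of n]
        unstraighten_straighten [of _ n] straighten_unstraighten [of _ n]
      unfolding r
      by (intro rational_reparametrization_in_maximal_atlas [OF M, where \<Theta>' = "unstraighten n"])
         (simp_all add: dim_M)
    have pU: "p \<in> ?U"
      using p \<open>fst p \<in> carrier_mat n m\<close> by (simp add: mem_Times_iff)
    have "(straighten n \<circ> ?\<Phi>) q \<in> topspace (Euclidean_space (n * r + r * k)) \<longleftrightarrow> q \<in> ?S"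
      if "q \<in> ?U" for q
    proof -
      obtain A c where q: "q = (A, c)" "A \<in> carrier_mat n m" "c \<in> chart_domain"
        using \<open>q \<in> ?U\<close> by auto
      moreover have "c \<in> grassmannian k m"
        using q(3) by (simp add: grassmann_chart_def)
      ultimately show ?thesis
        using slice_chart_in_slice_iff [OF q(2,3)] by (simp add: S r)
    qed
    then have image: "(straighten n \<circ> ?\<Phi>) ` (?U \<inter> ?S) =
        (straighten n \<circ> ?\<Phi>) ` ?U \<inter> topspace (Euclidean_space (n * r + r * k))"
      by blast
    show ?thesis
      by (rule bexI [OF _ max], unfold prod.case, intro conjI pU image)
  qed
  have S_subset: "?S \<subseteq> topspace (mfd_top ?M)"
    by (auto simp: S prod_manifold_def mat_manifold_def grassmann_manifold_def
        topspace_mat_topology topspace_grassmann_topology)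
  have dim_le: "n * r + r * k \<le> mfd_dim ?M"
    using \<open>r \<le> m\<close> by (simp add: dim_M)
  show ?thesis
    unfolding embedded_submanifold_def dim k_def [symmetric]
    by (intro conjI ballI rational_manifold_imp_smooth_manifold M S_subset dim_le slice)
qed

end
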